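(* Let $\lambda>0$, $k>0$, $\rho>0$, $\gamma>0$ and $y_r\in\mathbb{R}$ with $y_r\neq0$. Let $(\tilde u,\tilde\chi)\colon[0,\infty)\to\mathcal{L}^2(0,1)\oplus\mathbb{R}$ be any maximal solution of the error system $\dot{\tilde z}=A_e\tilde z$, where $\tilde z=(\tilde u,\tilde\chi)$, $$A_e\begin{bmatrix}\tilde u\\ \tilde\chi\end{bmatrix}:=\begin{bmatrix}\lambda\tilde u_{xx}-k\tilde u\\ -\rho\,\tilde u(1)\end{bmatrix},$$ $$D(A_e):=\left\{(\tilde u,\tilde\chi)\in\mathcal{H}^2(0,1)\oplus\mathbb{R}\colon \tilde u_x(0)=0,\ \tilde u_x(1)=-\gamma\tilde u(1)+\tilde\chi\right\}.$$ Let $\chi(t):=\tilde\chi(t)+\bar\chi$ with $\bar\chi:=\sqrt{\tfrac{k}{\lambda}}\tanh\!\left(\sqrt{\tfrac{k}{\lambda}}\right)y_r$, and define the estimated parameter $$\hat k(t):=g_\lambda^{-1}\!\left(\max\left\{0,\frac{\chi(t)}{y_r}\right\}\right).$$ Then $$\lim_{t\to+\infty}|k-\hat k(t)|=0 .$$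
   Context: The function $g_\lambda\colon[0,\infty)\to[0,\infty)$ is defined by $g_\lambda(k)=\sqrt{\tfrac{k}{\lambda}}\tanh\!\left(\sqrt{\tfrac{k}{\lambda}}\right)$; it is of class $\mathcal{K}^\infty$ (continuous, strictly increasing, zero at zero, unbounded), and $g_\lambda^{-1}\colon[0,\infty)\to[0,\infty)$ is its inverse. $\mathcal{H}^2(0,1):=\{f\in\mathcal{L}^2(0,1)\colon f,f'\text{ are absolutely continuous and } f''\in\mathcal{L}^2(0,1)\}$ (each up to choice of representative). Subscripts $x$, $xx$ denote first and second derivatives in $x\in[0,1]$. The space $\mathcal{X}=\mathcal{L}^2(0,1)\oplus\mathbb{R}$ is equipped with the inner product $\langle (u_1,\chi_1),(u_2,\chi_2)\rangle_{\mathcal{X}}:=\langle u_1,u_2\rangle_{\mathcal{L}^2(0,1)}+\frac{\lambda}{\rho}\chi_1\chi_2$. The operator $A_e$ generates a strongly continuous semigroup on $\mathcal{X}$. A solution of $\dot{\tilde z}=A_e\tilde z$ is a continuous $\varphi\colon[0,T)\to\mathcal{X}$ such that for all $t\in[0,T)$, $\int_0^t\varphi(s)\,ds\in D(A_e)$ and $\varphi(t)=\varphi(0)+A_e\int_0^t\varphi(s)\,ds$; it is maximal if its domain cannot be extended. Background: the error system arises from the plant $u_t=\lambda u_{xx}-ku$ on $[0,1]$, $u_x(0,t)=0$, $u_x(1,t)=v(t)$, with measured output $y(t)=u(1,t)$, in closed loop with the compensator $\dot\chi=-\rho(y-y_r)$, $v=\chi-\gamma(y-y_r)$. Its unique equilibrium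 is $(\bar u,\bar\chi)$ with $\bar u(x)=\frac{\cosh(\sqrt{k/\lambda}\,x)}{\cosh(\sqrt{k/\lambda})}y_r$ and $\bar\chi=g_\lambda(k)y_r$, and the error variables are $\tilde u=u-\bar u$, $\tilde\chi=\chi-\bar\chi$. *)

theory Defs
  imports "HOL-Analysis.Analysis"
begin

section \<open>The Hilbert space of square-integrable functions on the unit interval\<close>

abbreviation unit_measure :: "real measure" where
  "unit_measure \<equiv> lebesgue_on {0<..<1}"

definition sq_integrable :: "(real \<Rightarrow> real) \<Rightarrow> bool" where
  "sq_integrable f \<longleftrightarrow>
     f \<in> borel_measurable unit_measure \<and> integrable unit_measure (\<lambda>x. (f x)\<^sup>2)"

definition l2_rel :: "(real \<Rightarrow> real) \<Rightarrow> (real \<Rightarrow> real) \<Rightarrow> bool" where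
  "l2_rel f g \<longleftrightarrow> sq_integrable f \<and> sq_integrable g \<and> (AE x in unit_measure. f x = g x)"

lemma sq_integrable_zero: "sq_integrable (\<lambda>x. 0)"
  by (simp add: sq_integrable_def)

lemma sq_integrable_scale: "sq_integrable f \<Longrightarrow> sq_integrable (\<lambda>x. c * f x)"
  by (auto simp: sq_integrable_def power_mult_distrib)

lemma sq_integrable_mult:
  assumes "sq_integrable f" "sq_integrable g"
  shows "integrable unit_measure (\<lambda>x. f x * g x)"
proof (rule Bochner_Integration.integrable_bound)
  show "integrable unit_measure (\<lambda>x. (f x)\<^sup>2 + (g x)\<^sup>2)"
    using assms by (simp add: sq_integrable_def)
  show "(\<lambda>x. f x * g x) \<in> borel_measurable unit_measure"
    using assms by (auto simp: sq_integrable_def)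
  have "\<bar>a * b\<bar> \<le> a\<^sup>2 + b\<^sup>2" for a b :: real
  proof -
    have "2 * \<bar>a\<bar> * \<bar>b\<bar> \<le> a\<^sup>2 + b\<^sup>2"
      using sum_squares_bound[of "\<bar>a\<bar>" "\<bar>b\<bar>"] by simp
    moreover have "0 \<le> \<bar>a\<bar> * \<bar>b\<bar>" by simp
    ultimately show ?thesis unfolding abs_mult by linarith
  qed
  then show "AE x in unit_measure. norm (f x * g x) \<le> norm ((f x)\<^sup>2 + (g x)\<^sup>2)"
    by simp
qed

lemma sq_integrable_add:
  assumes "sq_integrable f" "sq_integrable g"
  shows "sq_integrable (\<lambda>x. f x + g x)"
proof -
  have "integrable unit_measure (\<lambda>x. (f x)\<^sup>2 + (g x)\<^sup>2 + 2 * (f x * g x))"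
    using assms sq_integrable_mult[OF assms] by (simp add: sq_integrable_def)
  then show ?thesis
    using assms by (auto simp: sq_integrable_def power2_sum mult.assoc)
qed

quotient_type l2 = "real \<Rightarrow> real" / partial: l2_rel
  morphisms rep_l2 abs_l2
proof (rule part_equivpI)
  show "\<exists>f. l2_rel f f"
    using sq_integrable_zero by (auto simp: l2_rel_def)
  show "symp l2_rel"
    by (rule sympI) (auto simp: l2_rel_def)
  show "transp l2_rel"
    by (rule transpI) (auto simp: l2_rel_def elim: AE_mp)
qed

lemma l2_rel_refl: "l2_rel f f \<longleftrightarrow> sq_integrable f"
  by (simp add: l2_rel_def)

instantiation l2 :: real_inner
begin

lift_definition zero_l2 :: l2 is "\<lambda>x. 0"
  by (simp add: l2_rel_def sq_integrable_zero)

lift_definition plus_l2 :: "l2 \<Rightarrow> l2 \<Rightarrow> l2" is "\<lambda>f g x. f x + g x"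
  by (auto simp: l2_rel_def sq_integrable_add elim!: AE_mp)

lift_definition scaleR_l2 :: "real \<Rightarrow> l2 \<Rightarrow> l2" is "\<lambda>c f x. c * f x"
  by (auto simp: l2_rel_def sq_integrable_scale elim!: AE_mp)

lift_definition inner_l2 :: "l2 \<Rightarrow> l2 \<Rightarrow> real" is
  "\<lambda>f g. \<integral>x. f x * g x \<partial>unit_measure"
  by (rule integral_cong_AE) (auto simp: l2_rel_def sq_integrable_def elim!: AE_mp)

definition uminus_l2 :: "l2 \<Rightarrow> l2" where "uminus_l2 u = (-1) *\<^sub>R u"
definition minus_l2 :: "l2 \<Rightarrow> l2 \<Rightarrow> l2" where "minus_l2 u v = u + (-1) *\<^sub>R v"
definition norm_l2 :: "l2 \<Rightarrow> real" where "norm_l2 u = sqrt (inner u u)"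
definition sgn_l2 :: "l2 \<Rightarrow> l2" where "sgn_l2 u = inverse (norm u) *\<^sub>R u"
definition dist_l2 :: "l2 \<Rightarrow> l2 \<Rightarrow> real" where "dist_l2 u v = norm (u - v)"
definition uniformity_l2 :: "(l2 \<times> l2) filter" where
  "uniformity_l2 = (INF e\<in>{0<..}. principal {(u, v). dist u v < e})"
definition open_l2 :: "l2 set \<Rightarrow> bool" where
  "open_l2 U \<longleftrightarrow> (\<forall>u\<in>U. eventually (\<lambda>(u', v). u' = u \<longrightarrow> v \<in> U) uniformity)"

instance
proof
  fix u v w :: l2 and a b :: real
  show "u + v + w = u + (v + w)"
    by transfer (auto simp: l2_rel_def sq_integrable_add add.assoc)
  show "u + v = v + u"
    by transfer (auto simp: l2_rel_def sq_integrable_add add.commute)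
  show "0 + u = u"
    by transfer (auto simp: l2_rel_def)
  show "- u + u = 0"
    unfolding uminus_l2_def
    by transfer (simp add: l2_rel_def sq_integrable_zero)
  show "u - v = u + - v"
    by (simp add: uminus_l2_def minus_l2_def)
  show "a *\<^sub>R (u + v) = a *\<^sub>R u + a *\<^sub>R v"
    by transfer (auto simp: l2_rel_def sq_integrable_add sq_integrable_scale distrib_left)
  show "(a + b) *\<^sub>R u = a *\<^sub>R u + b *\<^sub>R u"
    by transfer (auto simp: l2_rel_def sq_integrable_add sq_integrable_scale distrib_right)
  show "a *\<^sub>R b *\<^sub>R u = (a * b) *\<^sub>R u"
    by transfer (auto simp: l2_rel_def sq_integrable_scale mult.assoc
        intro: sq_integrable_scale[of _ "a * b", unfolded mult.assoc])
  show "1 *\<^sub>R u = u"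
    by transfer (auto simp: l2_rel_def)
  show "dist u v = norm (u - v)" by (rule dist_l2_def)
  show "sgn u = inverse (norm u) *\<^sub>R u" by (rule sgn_l2_def)
  show "uniformity = (INF e\<in>{0<..}. principal {(u::l2, v). dist u v < e})"
    by (rule uniformity_l2_def)
  show "open U \<longleftrightarrow> (\<forall>u\<in>U. eventually (\<lambda>(u', v). u' = u \<longrightarrow> v \<in> U) uniformity)" for U :: "l2 set"
    by (rule open_l2_def)
  show "norm u = sqrt (inner u u)" by (rule norm_l2_def)
  show "inner u v = inner v u"
    by transfer (simp add: mult.commute)
  show "inner (u + v) w = inner u w + inner v w"
    by transfer (simp add: l2_rel_refl distrib_right sq_integrable_mult)
  show "inner (a *\<^sub>R u) v = a * inner u v"
    by transfer (simp add: mult.assoc)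
  show "0 \<le> inner u u"
    by transfer simp
  show "inner u u = 0 \<longleftrightarrow> u = 0"
  proof transfer
    fix f :: "real \<Rightarrow> real" assume "l2_rel f f"
    then have f: "sq_integrable f" by (simp add: l2_rel_refl)
    have "(\<integral>x. f x * f x \<partial>unit_measure) = 0 \<longleftrightarrow> (AE x in unit_measure. f x * f x = 0)"
      by (rule integral_nonneg_eq_0_iff_AE) (simp_all add: sq_integrable_mult f)
    then show "(\<integral>x. f x * f x \<partial>unit_measure) = 0 \<longleftrightarrow> l2_rel f (\<lambda>x. 0)"
      using f by (simp add: l2_rel_def sq_integrable_zero)
  qed
qed

end

lemma abs_l2_eq_iff:
  assumes "sq_integrable f" "sq_integrable g"
  shows "abs_l2 f = abs_l2 g \<longleftrightarrow> (AE x in unit_measure. f x = g x)"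
  using assms Quotient_rel_abs[OF Quotient_l2]
  by (metis (no_types, lifting) Quotient_l2 Quotient_rel l2_rel_def l2_rel_refl)

lemma l2_cases: obtains f where "sq_integrable f" "u = abs_l2 f"
  by (metis Quotient_abs_rep[OF Quotient_l2] Quotient_rep_reflp[OF Quotient_l2] l2_rel_refl)

lemma norm_abs_l2_sq:
  assumes "sq_integrable f"
  shows "(norm (abs_l2 f))\<^sup>2 = (\<integral>x. (f x)\<^sup>2 \<partial>unit_measure)"
  unfolding power2_norm_eq_inner
  using assms by (simp add: inner_l2.abs_eq l2_rel_refl power2_eq_square)

lemma abs_l2_diff:
  assumes "sq_integrable f" "sq_integrable g"
  shows "sq_integrable (\<lambda>x. f x - g x)" "abs_l2 f - abs_l2 g = abs_l2 (\<lambda>x. f x - g x)"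
proof -
  note m = sq_integrable_scale[OF assms(2), of "-1"]
  show "sq_integrable (\<lambda>x. f x - g x)"
    using sq_integrable_add[OF assms(1) m] by simp
  have "(-1) *\<^sub>R abs_l2 g = abs_l2 (\<lambda>x. -1 * g x)"
    by (rule scaleR_l2.abs_eq) (simp add: l2_rel_refl assms)
  moreover have "abs_l2 f + abs_l2 (\<lambda>x. -1 * g x) = abs_l2 (\<lambda>x. f x + -1 * g x)"
    by (rule plus_l2.abs_eq) (unfold l2_rel_refl, fact assms, fact m)
  ultimately show "abs_l2 f - abs_l2 g = abs_l2 (\<lambda>x. f x - g x)"
    by (simp add: minus_l2_def)
qed

lemma integral_abs_le_norm_l2:
  assumes h: "sq_integrable h"
  shows "integrable unit_measure h" "(\<integral>x. \<bar>h x\<bar> \<partial>unit_measure) \<le> norm (abs_l2 h)"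
proof -
  have one: "sq_integrable (\<lambda>x. 1)"
    unfolding sq_integrable_def
    by (intro conjI borel_measurable_const finite_measure.integrable_const
        finite_measure_lebesgue_on) simp
  have abs: "sq_integrable (\<lambda>x. \<bar>h x\<bar>)"
    using h unfolding sq_integrable_def by (intro conjI borel_measurable_abs) auto
  show "integrable unit_measure h"
    using sq_integrable_mult[OF h one] by simp
  have "inner (abs_l2 (\<lambda>x. \<bar>h x\<bar>)) (abs_l2 (\<lambda>x. 1)) = (\<integral>x. \<bar>h x\<bar> * 1 \<partial>unit_measure)"
    by (rule inner_l2.abs_eq) (unfold l2_rel_refl, fact abs, fact one)
  then have "(\<integral>x. \<bar>h x\<bar> \<partial>unit_measure) = inner (abs_l2 (\<lambda>x. \<bar>h x\<bar>)) (abs_l2 (\<lambda>x. 1))"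
    by simp
  also have "\<dots> \<le> norm (abs_l2 (\<lambda>x. \<bar>h x\<bar>)) * norm (abs_l2 (\<lambda>x. 1))"
    by (rule norm_cauchy_schwarz)
  also have "norm (abs_l2 (\<lambda>x. \<bar>h x\<bar>)) = norm (abs_l2 h)"
  proof (rule power2_eq_imp_eq)
    show "(norm (abs_l2 (\<lambda>x. \<bar>h x\<bar>)))\<^sup>2 = (norm (abs_l2 h))\<^sup>2"
      unfolding norm_abs_l2_sq[OF h] norm_abs_l2_sq[OF abs] by simp
  qed (rule norm_ge_zero)+
  also have "norm (abs_l2 (\<lambda>x. 1)) = 1"
  proof (rule power2_eq_imp_eq)
    show "(norm (abs_l2 (\<lambda>x. 1)))\<^sup>2 = 1\<^sup>2"
      unfolding norm_abs_l2_sq[OF one] by (simp add: measure_restrict_space)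
  qed simp_all
  finally show "(\<integral>x. \<bar>h x\<bar> \<partial>unit_measure) \<le> norm (abs_l2 h)" by simp
qed

text \<open>The Riesz--Fischer theorem: the quotient space is complete.\<close>

instance l2 :: banach
proof
  fix X :: "nat \<Rightarrow> l2" assume X: "Cauchy X"
  have ex: "\<exists>N. \<forall>m\<ge>N. \<forall>n\<ge>N. norm (X m - X n) < e" if "e > 0" for e
    using X that unfolding Cauchy_def dist_norm by blast
  obtain r where r: "strict_mono r" "\<And>n i. i \<ge> r n \<Longrightarrow> norm (X i - X (r n)) < (1/2) ^ n"
  proof -
    have "\<exists>r. \<forall>n. (\<forall>i\<ge>r n. norm (X i - X (r n)) < (1/2) ^ n) \<and> r n < (r (Suc n) :: nat)"
    proof (rule dependent_nat_choice)
      show "\<exists>x. \<forall>i\<ge>x. norm (X i - X x) < (1/2) ^ 0"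
        using ex[of 1] by auto
    next
      fix x n :: nat
      obtain N where "\<forall>m\<ge>N. \<forall>k\<ge>N. norm (X m - X k) < (1/2) ^ Suc n"
        using ex[of "(1/2) ^ Suc n"] by auto
      then show "\<exists>y. (\<forall>i\<ge>y. norm (X i - X y) < (1/2) ^ Suc n) \<and> x < y"
        by (intro exI[of _ "max N (Suc x)"]) auto
    qed
    then obtain r where "\<forall>n. (\<forall>i\<ge>r n. norm (X i - X (r n)) < (1/2) ^ n) \<and> r n < (r (Suc n) :: nat)"
      by (rule exE)
    then show ?thesis by (intro that[of r]) (simp_all add: strict_mono_Suc_iff)
  qed
  obtain f where f: "\<And>n. sq_integrable (f n)" "\<And>n. X (r n) = abs_l2 (f n)"
  proof -
    have "\<forall>n. \<exists>h. sq_integrable h \<and> X (r n) = abs_l2 h"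
      by (rule allI, rule l2_cases) (rule exI, rule conjI)
    then have "\<exists>f. \<forall>n. sq_integrable (f n) \<and> X (r n) = abs_l2 (f n)"
      by (rule choice)
    then show ?thesis using that by blast
  qed
  have meas [measurable]: "f n \<in> borel_measurable unit_measure" for n
    using f(1) by (simp add: sq_integrable_def)
  have bound: "(\<integral>\<^sup>+x. ennreal \<bar>f (Suc n) x - f n x\<bar> \<partial>unit_measure) \<le> ennreal ((1/2) ^ n)" for n
  proof -
    note d = abs_l2_diff[OF f(1)[of "Suc n"] f(1)[of n]]
    have "(\<integral>\<^sup>+x. ennreal \<bar>f (Suc n) x - f n x\<bar> \<partial>unit_measure)
        = ennreal (\<integral>x. \<bar>f (Suc n) x - f n x\<bar> \<partial>unit_measure)"
      by (rule nn_integral_eq_integral) (simp_all add: integral_abs_le_norm_l2(1)[OF d(1)])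
    also have "\<dots> \<le> ennreal (norm (X (r (Suc n)) - X (r n)))"
      using integral_abs_le_norm_l2(2)[OF d(1)] d(2) f(2) by (intro ennreal_leI) simp
    also have "\<dots> \<le> ennreal ((1/2) ^ n)"
      using r(2)[of n "r (Suc n)"] strict_monoD[OF r(1), of n "Suc n"]
      by (intro ennreal_leI) simp
    finally show ?thesis .
  qed
  have "(\<integral>\<^sup>+x. (\<Sum>n. ennreal \<bar>f (Suc n) x - f n x\<bar>) \<partial>unit_measure)
      = (\<Sum>n. \<integral>\<^sup>+x. ennreal \<bar>f (Suc n) x - f n x\<bar> \<partial>unit_measure)"
    by (rule nn_integral_suminf) measurable
  also have "\<dots> \<le> (\<Sum>n. ennreal ((1/2) ^ n))"
    by (intro suminf_le bound summableI)
  also have "\<dots> = ennreal (\<Sum>n. (1/2) ^ n)"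
    by (rule suminf_ennreal2) (simp_all add: summable_geometric)
  finally have "(\<integral>\<^sup>+x. (\<Sum>n. ennreal \<bar>f (Suc n) x - f n x\<bar>) \<partial>unit_measure) \<noteq> \<infinity>"
    by (auto simp: top_unique)
  then have "AE x in unit_measure. (\<Sum>n. ennreal \<bar>f (Suc n) x - f n x\<bar>) \<noteq> \<infinity>"
    by (intro nn_integral_PInf_AE) auto
  then have conv: "AE x in unit_measure. convergent (\<lambda>n. f n x)"
  proof (rule AE_mp, intro AE_I2 impI)
    fix x assume "(\<Sum>n. ennreal \<bar>f (Suc n) x - f n x\<bar>) \<noteq> \<infinity>"
    then have "summable (\<lambda>n. \<bar>f (Suc n) x - f n x\<bar>)"
      by (intro summable_suminf_not_top) auto
    then have "summable (\<lambda>n. f (Suc n) x - f n x)"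
      by (rule summable_rabs_cancel)
    then have "convergent (\<lambda>n. \<Sum>i<n. f (Suc i) x - f i x)"
      by (simp add: summable_iff_convergent)
    then have "convergent (\<lambda>n. f n x - f 0 x)"
      unfolding sum_lessThan_telescope[of "\<lambda>n. f n x"] .
    then have "convergent (\<lambda>n. (f n x - f 0 x) + f 0 x)"
      by (intro convergent_add convergent_const)
    then show "convergent (\<lambda>n. f n x)" by simp
  qed
  define F where "F x = lim (\<lambda>n. f n x)" for x
  have F_meas [measurable]: "F \<in> borel_measurable unit_measure"
    unfolding F_def by (rule borel_measurable_lim_metric) measurable
  have fatou: "(\<integral>\<^sup>+x. ennreal ((F x - f m x)\<^sup>2) \<partial>unit_measure) \<le> ennreal (((1/2) ^ m)\<^sup>2)" for m
  proof -
    have "(\<integral>\<^sup>+x. ennreal ((F x - f m x)\<^sup>2) \<partial>unit_measure)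
        = (\<integral>\<^sup>+x. liminf (\<lambda>n. ennreal ((f n x - f m x)\<^sup>2)) \<partial>unit_measure)"
    proof (rule nn_integral_cong_AE, use conv in eventually_elim)
      fix x assume "convergent (\<lambda>n. f n x)"
      then have "(\<lambda>n. f n x) \<longlonglongrightarrow> F x"
        by (simp add: F_def convergent_LIMSEQ_iff)
      then have "(\<lambda>n. ennreal ((f n x - f m x)\<^sup>2)) \<longlonglongrightarrow> ennreal ((F x - f m x)\<^sup>2)"
        by (intro tendsto_intros)
      then show "ennreal ((F x - f m x)\<^sup>2) = liminf (\<lambda>n. ennreal ((f n x - f m x)\<^sup>2))"
        by (intro lim_imp_Liminf[symmetric]) auto
    qed
    also have "\<dots> \<le> liminf (\<lambda>n. \<integral>\<^sup>+x. ennreal ((f n x - f m x)\<^sup>2) \<partial>unit_measure)"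
      by (rule nn_integral_liminf) measurable
    also have "\<dots> \<le> liminf (\<lambda>n::nat. ennreal (((1/2) ^ m)\<^sup>2))"
    proof (rule Liminf_mono, rule eventually_sequentiallyI)
      fix n assume "m \<le> n"
      note d = abs_l2_diff[OF f(1)[of n] f(1)[of m]]
      have "(\<integral>\<^sup>+x. ennreal ((f n x - f m x)\<^sup>2) \<partial>unit_measure)
          = ennreal (\<integral>x. (f n x - f m x)\<^sup>2 \<partial>unit_measure)"
        by (rule nn_integral_eq_integral) (use d(1) in \<open>simp_all add: sq_integrable_def\<close>)
      also have "\<dots> = ennreal ((norm (X (r n) - X (r m)))\<^sup>2)"
        using norm_abs_l2_sq[OF d(1)] d(2) f(2) by simp
      also have "\<dots> \<le> ennreal (((1/2) ^ m)\<^sup>2)"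
        using r(2)[of m "r n"] strict_mono_less_eq[OF r(1)] \<open>m \<le> n\<close>
        by (intro ennreal_leI power_mono) (auto intro: less_imp_le)
      finally show "(\<integral>\<^sup>+x. ennreal ((f n x - f m x)\<^sup>2) \<partial>unit_measure) \<le> ennreal (((1/2) ^ m)\<^sup>2)" .
    qed
    finally show ?thesis by (simp add: Liminf_const)
  qed
  have D: "sq_integrable (\<lambda>x. F x - f m x)" for m
    unfolding sq_integrable_def
  proof
    show "integrable unit_measure (\<lambda>x. (F x - f m x)\<^sup>2)"
      by (rule integrableI_nonneg) (auto intro: le_less_trans[OF fatou])
  qed measurable
  have F: "sq_integrable F"
    using sq_integrable_add[OF D[of 0] f(1)[of 0]] by simp
  have le: "norm (X (r m) - abs_l2 F) \<le> (1/2) ^ m" for m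
  proof (rule power2_le_imp_le)
    have "(norm (abs_l2 F - X (r m)))\<^sup>2 = (\<integral>x. (F x - f m x)\<^sup>2 \<partial>unit_measure)"
      using norm_abs_l2_sq[OF D] abs_l2_diff(2)[OF F f(1)] f(2) by simp
    also have "ennreal \<dots> \<le> ennreal (((1/2) ^ m)\<^sup>2)"
      using fatou[of m] D[of m]
      by (subst nn_integral_eq_integral[symmetric]) (simp_all add: sq_integrable_def)
    finally show "(norm (X (r m) - abs_l2 F))\<^sup>2 \<le> ((1/2) ^ m)\<^sup>2"
      by (simp add: norm_minus_commute)
  qed simp
  have "(X \<circ> r) \<longlonglongrightarrow> abs_l2 F"
    unfolding LIM_zero_iff[symmetric, of _ "abs_l2 F"]
    by (rule Lim_null_comparison[where g = "\<lambda>m. (1/2) ^ m"])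
      (use le in \<open>auto intro: LIMSEQ_power_zero\<close>)
  then show "convergent X"
    using Cauchy_converges_subseq[OF X r(1)] unfolding convergent_def o_def by blast
qed


section \<open>Absolutely continuous representatives\<close>

definition abs_cont_on :: "real \<Rightarrow> real \<Rightarrow> (real \<Rightarrow> real) \<Rightarrow> bool" where
  "abs_cont_on a b f \<longleftrightarrow>
     (\<forall>\<epsilon>>0. \<exists>\<delta>>0. \<forall>I :: (real \<times> real) set.
        finite I \<longrightarrow> (\<forall>(s, t)\<in>I. a \<le> s \<and> s \<le> t \<and> t \<le> b) \<longrightarrow>
        pairwise (\<lambda>(s, t) (s', t'). disjnt {s<..<t} {s'<..<t'}) I \<longrightarrow>
        (\<Sum>(s, t)\<in>I. t - s) < \<delta> \<longrightarrow> (\<Sum>(s, t)\<in>I. \<bar>f t - f s\<bar>) < \<epsilon>)"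

text \<open>An absolutely continuous function is differentiable only almost everywhere, so its
  derivative is a class of functions modulo null sets.\<close>

definition has_l2_deriv :: "l2 \<Rightarrow> l2 \<Rightarrow> bool" where
  "has_l2_deriv u v \<longleftrightarrow>
     (\<exists>f f'. abs_cont_on 0 1 f \<and> sq_integrable f \<and> u = abs_l2 f \<and>
        (AE x in unit_measure. (f has_real_derivative f' x) (at x)) \<and>
        sq_integrable f' \<and> v = abs_l2 f')"

definition l2_deriv :: "l2 \<Rightarrow> l2" where
  "l2_deriv u = (THE v. has_l2_deriv u v)"

text \<open>The space H^2(0,1). Square integrability of the first derivative is no extra condition:
  it follows from its absolute continuity.\<close>

definition H2 :: "l2 set" where
  "H2 = {u. \<exists>v w. has_l2_deriv u v \<and> has_l2_deriv v w}"

text \<open>The value at a point of [0,1] of the absolutely continuous representative.\<close>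

definition point_value :: "l2 \<Rightarrow> real \<Rightarrow> real" where
  "point_value u x =
     (THE y. \<exists>f. abs_cont_on 0 1 f \<and> sq_integrable f \<and> u = abs_l2 f \<and> y = f x)"


lemma abs_cont_on_imp_continuous_on:
  assumes "abs_cont_on a b f"
  shows "continuous_on {a..b} f"
  unfolding continuous_on_iff
proof (intro ballI allI impI)
  fix x e :: real assume x: "x \<in> {a..b}" and e: "e > 0"
  then obtain d where d: "d > 0" and *: "\<And>I. finite I \<Longrightarrow> (\<forall>(s, t)\<in>I. a \<le> s \<and> s \<le> t \<and> t \<le> b) \<Longrightarrow>
        pairwise (\<lambda>(s, t) (s', t'). disjnt {s<..<t} {s'<..<t'}) I \<Longrightarrow>
        (\<Sum>(s, t)\<in>I. t - s) < d \<Longrightarrow> (\<Sum>(s, t)\<in>I. \<bar>f t - f s\<bar>) < e"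
    using assms unfolding abs_cont_on_def by meson
  show "\<exists>d>0. \<forall>x'\<in>{a..b}. dist x' x < d \<longrightarrow> dist (f x') (f x) < e"
  proof (intro exI conjI ballI impI)
    fix y assume y: "y \<in> {a..b}" "dist y x < d"
    show "dist (f y) (f x) < e"
    proof (cases "x \<le> y")
      case True
      then show ?thesis using *[of "{(x, y)}"] x y by (simp add: dist_real_def)
    next
      case False
      then show ?thesis using *[of "{(y, x)}"] x y by (simp add: dist_real_def abs_minus_commute)
    qed
  qed (fact d)
qed

lemma abs_cont_rep_unique:
  assumes "abs_cont_on 0 1 f" "sq_integrable f" "abs_cont_on 0 1 g" "sq_integrable g"
    and "abs_l2 f = abs_l2 g" and x: "x \<in> {0..1}"
  shows "f x = g x"
proof -
  have cont: "continuous_on {0..1} (\<lambda>x. f x - g x)"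
    using assms by (intro continuous_on_diff abs_cont_on_imp_continuous_on)
  have ae: "AE x in unit_measure. f x = g x"
    using abs_l2_eq_iff[OF assms(2,4)] assms(5) by simp
  have eq: "f y - g y = 0" if y: "y \<in> {0<..<1}" for y
  proof (rule ccontr)
    assume ne: "f y - g y \<noteq> 0"
    have "continuous_on {0<..<1} (\<lambda>x. f x - g x)"
      by (rule continuous_on_subset[OF cont]) auto
    then have "open ({0<..<1} \<inter> (\<lambda>x. f x - g x) -` (- {0}))"
      by (rule continuous_open_preimage) auto
    moreover have "y \<in> {0<..<1} \<inter> (\<lambda>x. f x - g x) -` (- {0})"
      using y ne by auto
    ultimately obtain e where e: "e > 0" "ball y e \<subseteq> {0<..<1} \<inter> (\<lambda>x. f x - g x) -` (- {0})"
      by (meson openE)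
    have "AE x in lebesgue. x \<in> {0<..<1} \<longrightarrow> f x = g x"
      using ae by (simp add: AE_restrict_space_iff)
    then have "AE x in lebesgue. x \<notin> ball y e"
      by (rule AE_mp) (use e in \<open>auto intro!: AE_I2\<close>)
    then have "ball y e \<in> null_sets lebesgue"
      by (subst AE_iff_null_sets) (auto simp: eventually_mono)
    then show False
      using e(1) open_not_negligible[of "ball y e"] by (simp add: negligible_iff_null_sets)
  qed
  have "closed {z \<in> {0..1}. f z - g z = 0}"
    by (rule continuous_closed_preimage_constant[OF cont]) simp
  moreover have "{0<..<1} \<subseteq> {z \<in> {0..1}. f z - g z = 0}"
    using eq by auto
  ultimately have "closure {0<..<1::real} \<subseteq> {z \<in> {0..1}. f z - g z = 0}"
    by (rule closure_minimal[rotated])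
  then show ?thesis using x by (auto simp: subset_iff)
qed

lemma point_value_eq:
  assumes "abs_cont_on 0 1 f" "sq_integrable f" "x \<in> {0..1}"
  shows "point_value (abs_l2 f) x = f x"
  unfolding point_value_def
proof (rule the_equality)
  show "\<exists>h. abs_cont_on 0 1 h \<and> sq_integrable h \<and> abs_l2 f = abs_l2 h \<and> f x = h x"
    using assms(1,2) by blast
next
  fix y assume "\<exists>h. abs_cont_on 0 1 h \<and> sq_integrable h \<and> abs_l2 f = abs_l2 h \<and> y = h x"
  then obtain h where "abs_cont_on 0 1 h" "sq_integrable h" "abs_l2 f = abs_l2 h" "y = h x"
    by blast
  with abs_cont_rep_unique[OF assms(1,2) this(1-3) assms(3)] show "y = f x" by simp
qed

lemma l2_deriv_eq:
  assumes "has_l2_deriv u v"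
  shows "l2_deriv u = v"
  unfolding l2_deriv_def
proof (rule the_equality, fact assms)
  fix w assume "has_l2_deriv u w"
  with assms obtain f f' g g' where
    f: "abs_cont_on 0 1 f" "sq_integrable f" "u = abs_l2 f" "sq_integrable f'" "v = abs_l2 f'"
       "AE x in unit_measure. (f has_real_derivative f' x) (at x)" and
    g: "abs_cont_on 0 1 g" "sq_integrable g" "u = abs_l2 g" "sq_integrable g'" "w = abs_l2 g'"
       "AE x in unit_measure. (g has_real_derivative g' x) (at x)"
    unfolding has_l2_deriv_def by blast
  have eq: "f x = g x" if "x \<in> {0<..<1}" for x
    using abs_cont_rep_unique[OF f(1,2) g(1,2), of x] f(3) g(3) that by simp
  have "AE x in unit_measure. x \<in> {0<..<1}"
    by (rule AE_I2) simp
  with f(6) g(6) have "AE x in unit_measure. g' x = f' x"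
  proof eventually_elim
    case (elim x)
    have "(g has_real_derivative f' x) (at x)"
      by (rule has_field_derivative_transform_within_open[OF elim(1), of "{0<..<1}"])
        (use eq elim(3) in auto)
    then show ?case using elim(2) DERIV_unique by blast
  qed
  then show "w = v" unfolding f(5) g(5) abs_l2_eq_iff[OF g(4) f(4)] .
qed


section \<open>The state space\<close>

text \<open>The state space is the product type \<^typ>\<open>l2 \<times> real\<close>. Its built-in norm differs from the one
  induced by the weighted inner product below, but the two are equivalent, so continuity and
  vector-valued integration do not depend on the choice.\<close>

definition inner_X :: "real \<Rightarrow> real \<Rightarrow> l2 \<times> real \<Rightarrow> l2 \<times> real \<Rightarrow> real" where
  "inner_X lam rho z w = inner (fst z) (fst w) + lam / rho * (snd z * snd w)"

definition norm_X :: "real \<Rightarrow> real \<Rightarrow> l2 \<times> real \<Rightarrow> real" where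
  "norm_X lam rho z = sqrt (inner_X lam rho z z)"

lemma tendsto_iff_norm_X:
  assumes "lam > 0" "rho > 0"
  shows "(f \<longlongrightarrow> z) F \<longleftrightarrow> ((\<lambda>t. norm_X lam rho (f t - z)) \<longlongrightarrow> 0) F"
proof -
  define c where "c = lam / rho"
  have c: "c > 0" using assms by (simp add: c_def)
  have eq: "norm_X lam rho w = sqrt ((norm (fst w))\<^sup>2 + c * (snd w)\<^sup>2)" for w
    by (simp add: norm_X_def inner_X_def c_def power2_norm_eq_inner[symmetric] power2_eq_square[symmetric])
  have nonneg: "0 \<le> norm_X lam rho w" for w
    using c by (simp add: eq)
  have le1: "norm w \<le> sqrt (1 + 1 / c) * norm_X lam rho w" for w
  proof -
    have "(norm (fst w))\<^sup>2 + (snd w)\<^sup>2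
        \<le> (1 + 1 / c) * ((norm (fst w))\<^sup>2 + c * (snd w)\<^sup>2)"
      using c by (simp add: algebra_simps divide_simps)
    then show ?thesis
      unfolding eq norm_prod_def real_sqrt_mult[symmetric] by (simp add: real_sqrt_le_mono)
  qed
  have le2: "norm_X lam rho w \<le> sqrt (1 + c) * norm w" for w
  proof -
    have "(norm (fst w))\<^sup>2 + c * (snd w)\<^sup>2 \<le> (1 + c) * ((norm (fst w))\<^sup>2 + (snd w)\<^sup>2)"
      using c by (simp add: algebra_simps)
    then show ?thesis
      unfolding eq norm_prod_def real_sqrt_mult[symmetric] by (simp add: real_sqrt_le_mono)
  qed
  show ?thesis
  proof
    assume "(f \<longlongrightarrow> z) F"
    then have "((\<lambda>t. sqrt (1 + c) * norm (f t - z)) \<longlongrightarrow> 0) F"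
      by (intro tendsto_mult_right_zero tendsto_norm_zero LIM_zero)
    then show "((\<lambda>t. norm_X lam rho (f t - z)) \<longlongrightarrow> 0) F"
      by (rule Lim_null_comparison[rotated]) (use le2 nonneg in auto)
  next
    assume "((\<lambda>t. norm_X lam rho (f t - z)) \<longlongrightarrow> 0) F"
    then have "((\<lambda>t. sqrt (1 + 1 / c) * norm_X lam rho (f t - z)) \<longlongrightarrow> 0) F"
      by (intro tendsto_mult_right_zero)
    then have "((\<lambda>t. f t - z) \<longlongrightarrow> 0) F"
      by (rule Lim_null_comparison[rotated]) (use le1 in auto)
    then show "(f \<longlongrightarrow> z) F" by (simp add: LIM_zero_iff)
  qed
qed


section \<open>Solutions of abstract Cauchy problems\<close>

text \<open>Solutions on [0,T) with 0 < T \<le> \<infinity>, for an operator \<open>A\<close> with domain \<open>D\<close>.\<close>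

definition is_solution ::
  "('a::real_normed_vector \<Rightarrow> 'a) \<Rightarrow> 'a set \<Rightarrow> ereal \<Rightarrow> (real \<Rightarrow> 'a) \<Rightarrow> bool" where
  "is_solution A D T \<phi> \<longleftrightarrow>
     0 < T \<and> continuous_on {t. 0 \<le> t \<and> ereal t < T} \<phi> \<and>
     (\<forall>t. 0 \<le> t \<and> ereal t < T \<longrightarrow>
        integral {0..t} \<phi> \<in> D \<and> \<phi> t = \<phi> 0 + A (integral {0..t} \<phi>))"

definition is_maximal_solution ::
  "('a::real_normed_vector \<Rightarrow> 'a) \<Rightarrow> 'a set \<Rightarrow> ereal \<Rightarrow> (real \<Rightarrow> 'a) \<Rightarrow> bool" where
  "is_maximal_solution A D T \<phi> \<longleftrightarrow>
     is_solution A D T \<phi> \<and>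
     \<not> (\<exists>T' \<psi>. T < T' \<and> is_solution A D T' \<psi> \<and>
          (\<forall>t. 0 \<le> t \<and> ereal t < T \<longrightarrow> \<psi> t = \<phi> t))"


section \<open>The error system\<close>

definition A_e :: "real \<Rightarrow> real \<Rightarrow> real \<Rightarrow> l2 \<times> real \<Rightarrow> l2 \<times> real" where
  "A_e lam k rho = (\<lambda>(u, c).
     (lam *\<^sub>R l2_deriv (l2_deriv u) - k *\<^sub>R u, - rho * point_value u 1))"

definition dom_A_e :: "real \<Rightarrow> (l2 \<times> real) set" where
  "dom_A_e gam = {(u, c). u \<in> H2 \<and>
     point_value (l2_deriv u) 0 = 0 \<and>
     point_value (l2_deriv u) 1 = - gam * point_value u 1 + c}"

definition g_lambda :: "real \<Rightarrow> real \<Rightarrow> real" where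
  "g_lambda lam k = sqrt (k / lam) * tanh (sqrt (k / lam))"

definition g_lambda_inv :: "real \<Rightarrow> real \<Rightarrow> real" where
  "g_lambda_inv lam = the_inv_into {0..} (g_lambda lam)"

lemma g_lambda_bij_betw:
  assumes "lam > 0"
  shows "bij_betw (g_lambda lam) {0..} {0..}"
proof -
  have mono: "strict_mono_on {0..} (g_lambda lam)"
  proof (rule strict_mono_onI)
    fix x y :: real assume "x \<in> {0..}" "y \<in> {0..}" "x < y"
    then have *: "0 \<le> sqrt (x / lam)" "sqrt (x / lam) < sqrt (y / lam)"
      using assms by (auto simp: divide_strict_right_mono)
    then have "tanh (sqrt (x / lam)) < tanh (sqrt (y / lam))" by simp
    with * show "g_lambda lam x < g_lambda lam y"
      unfolding g_lambda_def by (intro mult_strict_mono') auto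
  qed
  have cont: "continuous_on {0..} (g_lambda lam)"
    unfolding g_lambda_def using assms by (intro continuous_intros) auto
  have "y \<in> g_lambda lam ` {0..}" if y: "0 \<le> y" for y
  proof -
    have "filterlim (g_lambda lam) at_top at_top"
      unfolding g_lambda_def
    proof (rule filterlim_at_top_mult_tendsto_pos[where c = 1])
      have s: "filterlim (\<lambda>k. sqrt (k / lam)) at_top at_top"
        by (rule filterlim_compose[OF sqrt_at_top])
          (use assms in \<open>simp add: divide_inverse mult.commute[of _ "inverse lam"]
             filterlim_tendsto_pos_mult_at_top[OF tendsto_const _ filterlim_ident]\<close>)
      then show "filterlim (\<lambda>k. sqrt (k / lam)) at_top at_top" .
      show "((\<lambda>k. tanh (sqrt (k / lam))) \<longlongrightarrow> 1) at_top"
        by (rule filterlim_compose[OF tanh_real_at_top s])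
    qed simp
    then have "eventually (\<lambda>x. y \<le> g_lambda lam x \<and> 0 \<le> x) at_top"
      using eventually_ge_at_top[of 0] by (auto simp: filterlim_at_top intro: eventually_conj)
    then obtain b where b: "y \<le> g_lambda lam b" "0 \<le> b"
      using eventually_happens[of _ "at_top :: real filter"] by auto
    have "\<exists>x\<ge>0. x \<le> b \<and> g_lambda lam x = y"
      by (rule IVT') (use b y in \<open>auto simp: g_lambda_def intro!: continuous_on_subset[OF cont, unfolded g_lambda_def]\<close>)
    then show ?thesis by auto
  qed
  moreover have "0 \<le> g_lambda lam x" if "0 \<le> x" for x
    using that assms by (simp add: g_lambda_def)
  ultimately show ?thesis
    using strict_mono_on_imp_inj_on[OF mono] by (auto simp: bij_betw_def)
qed

end

theory Submission
  imports Defs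
begin

text \<open>For a mild solution \<open>\<phi>\<close> with primitive \<open>\<Phi>\<close>, the increments \<open>\<Phi>(t + h) - \<Phi>(t)\<close> lie in
  the domain and form a classical solution. On the domain, integration by parts shows that
  \<open>|u|\<^sup>2/2 + \<lambda>/(2\<rho>) c\<^sup>2 - \<epsilon> c \<integral>u\<close> is a strict Lyapunov function when \<open>\<epsilon>\<close> is small, hence decays
  exponentially along the increments. It is a quadratic form, so dividing by \<open>h\<^sup>2\<close> and letting
  \<open>h \<rightarrow> 0\<close> transfers the decay to \<open>\<phi>\<close> itself. Thus the error of \<open>\<chi>\<close> vanishes in the limit, and
  continuity of the inverse of \<open>g_lambda\<close> gives the claim.\<close>

section \<open>Absolutely continuous functions\<close>

text \<open>The cells of a tagged division have disjoint interiors, so those lying in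
  \<open>G\<close> have total length at most the measure of \<open>G\<close>; absolute continuity
  then makes the increments of \<open>f\<close> over them small.\<close>

lemma abs_cont_tagged_sum_less:
  fixes f :: "real \<Rightarrow> real"
  assumes D: "D tagged_division_of {a..b}" and P: "P \<subseteq> D"
    and G: "G \<in> lmeasurable" "\<And>x K. (x, K) \<in> P \<Longrightarrow> K \<subseteq> G" "measure lebesgue G < \<delta>"
    and ac: "\<And>I. finite I \<Longrightarrow> \<forall>(s, t)\<in>I. a \<le> s \<and> s \<le> t \<and> t \<le> b \<Longrightarrow>
        pairwise (\<lambda>(s, t) (s', t'). disjnt {s<..<t} {s'<..<t'}) I \<Longrightarrow>
        (\<Sum>(s, t)\<in>I. t - s) < \<delta> \<Longrightarrow> (\<Sum>(s, t)\<in>I. \<bar>f t - f s\<bar>) < \<epsilon>"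
  shows "(\<Sum>(x, K)\<in>P. \<bar>f (Sup K) - f (Inf K)\<bar>) < \<epsilon>"
proof -
  define h where "h = (\<lambda>(x :: real, K). (Inf K, Sup K :: real))"
  define I where "I = h ` P"
  have cell: "\<exists>s t. K = {s..t} \<and> s \<le> t \<and> a \<le> s \<and> t \<le> b" if xK: "(x, K) \<in> D" for x K
  proof -
    obtain s t where "K = {s..t}"
      using tagged_division_ofD(4)[OF D xK] by auto
    with tagged_division_ofD(2,3)[OF D xK] show ?thesis by auto
  qed
  have fin: "finite P"
    using P tagged_division_ofD(1)[OF D] by (rule finite_subset)
  have disj: "disjnt {Inf K<..<Sup K} {Inf L<..<Sup L}"
    if "(x, K) \<in> D" "(y, L) \<in> D" "(x, K) \<noteq> (y, L)" for x K y L
    using tagged_division_ofD(5)[OF D that] cell[OF that(1)] cell[OF that(2)]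
    by (auto simp: disjnt_def)
  have le: "Inf K \<le> Sup K" if "(x, K) \<in> P" for x K
    using cell[OF subsetD[OF P that]] by auto
  \<comment> \<open>Distinct members of \<open>P\<close> with the same endpoints would have disjoint
    interiors, hence degenerate cells, on which \<open>q\<close> vanishes; collapsing them in
    \<open>I\<close> does not change the sum.\<close>
  have reindex: "(\<Sum>(s, t)\<in>I. q s t) = (\<Sum>(x, K)\<in>P. q (Inf K) (Sup K))"
    if q: "\<And>s. q s s = (0 :: real)" for q
  proof -
    have z: "q (Inf K) (Sup K) = 0"
      if "(x, K) \<in> P" "(y, L) \<in> P" "(x, K) \<noteq> (y, L)" "Inf K = Inf L" "Sup K = Sup L" for x K y L
    proof -
      have "{Inf K<..<Sup K} = {}"
        using disj[OF subsetD[OF P that(1)] subsetD[OF P that(2)] that(3)] that(4,5)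
        by (simp add: disjnt_def)
      with le[OF that(1)] q show ?thesis by simp
    qed
    have "(\<Sum>(s, t)\<in>h ` P. q s t) = (\<Sum>z\<in>P. (case h z of (s, t) \<Rightarrow> q s t))"
      by (subst sum.reindex_nontrivial[OF fin]) (use z in \<open>force simp: h_def\<close>)+
    also have "\<dots> = (\<Sum>(x, K)\<in>P. q (Inf K) (Sup K))"
      by (rule sum.cong) (auto simp: h_def)
    finally show ?thesis by (simp add: I_def)
  qed
  have "(\<Sum>(s, t)\<in>I. \<bar>f t - f s\<bar>) < \<epsilon>"
  proof (rule ac)
    show "finite I" using fin by (simp add: I_def)
    show "\<forall>(s, t)\<in>I. a \<le> s \<and> s \<le> t \<and> t \<le> b"
      using cell[OF subsetD[OF P]] by (force simp: I_def h_def)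
    show pw: "pairwise (\<lambda>(s, t) (s', t'). disjnt {s<..<t} {s'<..<t'}) I"
      unfolding pairwise_def I_def h_def
      using disj[OF subsetD[OF P] subsetD[OF P]] by (clarsimp; metis)
    have "(\<Sum>(s, t)\<in>I. t - s) = (\<Sum>z\<in>I. measure lebesgue {fst z<..<snd z})"
      using le by (intro sum.cong) (auto simp: I_def h_def)
    also have "\<dots> = measure lebesgue (\<Union>z\<in>I. {fst z<..<snd z})"
    proof (rule measure_finite_Union[symmetric])
      show "disjoint_family_on (\<lambda>z. {fst z<..<snd z}) I"
        using pw unfolding pairwise_def disjoint_family_on_def disjnt_def case_prod_unfold by blast
      show "emeasure lebesgue {fst z<..<snd z} \<noteq> \<infinity>" for z :: "real \<times> real"
        by (cases "fst z \<le> snd z") auto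
    qed (use \<open>finite I\<close> in auto)
    also have "\<dots> \<le> measure lebesgue G"
    proof (rule measure_mono_fmeasurable[OF _ _ G(1)])
      have "{Inf K<..<Sup K} \<subseteq> G" if "(x, K) \<in> P" for x K
        using G(2)[OF that] cell[OF subsetD[OF P that]] by auto
      then show "(\<Union>z\<in>I. {fst z<..<snd z}) \<subseteq> G"
        by (force simp: I_def h_def)
    qed (use \<open>finite I\<close> in \<open>auto intro!: sets.finite_UN\<close>)
    finally show "(\<Sum>(s, t)\<in>I. t - s) < \<delta>" using G(3) by simp
  qed
  then show ?thesis by (subst (asm) reindex) simp_all
qed

text \<open>Henstock's straddle estimate: the first-order errors on the two sides of
  \<open>x\<close> add up, and \<open>(x - s) + (t - x)\<close> is \<open>t - s\<close> because
  \<open>x\<close> lies between.\<close>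

lemma has_real_derivative_straddle:
  assumes f: "(f has_real_derivative D) (at x within S)" and e: "e > 0"
  obtains d where "d > 0"
    "\<And>s t. s \<in> S \<Longrightarrow> t \<in> S \<Longrightarrow> s \<le> x \<Longrightarrow> x \<le> t \<Longrightarrow> {s, t} \<subseteq> ball x d \<Longrightarrow>
      \<bar>(t - s) * D - (f t - f s)\<bar> \<le> e * (t - s)"
proof -
  obtain d where d: "d > 0"
    "\<And>y. y \<in> S \<Longrightarrow> \<bar>y - x\<bar> < d \<Longrightarrow> \<bar>f y - f x - D * (y - x)\<bar> \<le> e * \<bar>y - x\<bar>"
    using f e unfolding has_field_derivative_def has_derivative_within_alt by fastforce
  show ?thesis
  proof (rule that[OF d(1)])
    fix s t assume st: "s \<in> S" "t \<in> S" "s \<le> x" "x \<le> t" "{s, t} \<subseteq> ball x d"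
    have "\<bar>f s - f x - D * (s - x)\<bar> \<le> e * (x - s)" "\<bar>f t - f x - D * (t - x)\<bar> \<le> e * (t - x)"
      using d(2)[of s] d(2)[of t] st by (auto simp: dist_real_def)
    then show "\<bar>(t - s) * D - (f t - f s)\<bar> \<le> e * (t - s)"
      by (auto simp: abs_le_iff algebra_simps)
  qed
qed

text \<open>The gauge sends the tags in the exceptional null set into a small open set covering it,
  so that absolute continuity controls their share of the Riemann sum.\<close>

theorem fundamental_theorem_of_calculus_abs_cont:
  assumes ab: "a \<le> b" and ac: "abs_cont_on a b f" and N: "negligible N"
    and der: "\<And>x. x \<in> {a..b} - N \<Longrightarrow> (f has_real_derivative f' x) (at x within {a..b})"
  shows "(f' has_integral f b - f a) {a..b}"
proof -
  \<comment> \<open>With the value 0 on \<open>N\<close>, tags in \<open>N\<close> contribute only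
    increments of \<open>f\<close>. The change is undone at the end because \<open>N\<close> is
    negligible.\<close>
  define F where "F x = (if x \<in> N then 0 else f' x)" for x
  have "(F has_integral f b - f a) {a..b}"
    unfolding has_integral_real
  proof (intro allI impI)
    fix e :: real assume e: "e > 0"
    \<comment> \<open>Tags off \<open>N\<close> may cost \<open>e / 2\<close>, spread over the
      length \<open>b - a\<close>; the added 1 covers \<open>a = b\<close> and makes the bound
      strict.\<close>
    define e1 where "e1 = e / (2 * (b - a + 1))"
    have e1: "e1 > 0" "e1 * (b - a) < e / 2"
      using ab e by (auto simp: e1_def field_simps)
    obtain \<delta> where \<delta>: "\<delta> > 0"
      "\<And>I. finite I \<Longrightarrow> \<forall>(s, t)\<in>I. a \<le> s \<and> s \<le> t \<and> t \<le> b \<Longrightarrow>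
        pairwise (\<lambda>(s, t) (s', t'). disjnt {s<..<t} {s'<..<t'}) I \<Longrightarrow>
        (\<Sum>(s, t)\<in>I. t - s) < \<delta> \<Longrightarrow> (\<Sum>(s, t)\<in>I. \<bar>f t - f s\<bar>) < e / 2"
      using ac[unfolded abs_cont_on_def, rule_format, OF half_gt_zero[OF e]] by blast
    have Nl: "N \<in> null_sets lebesgue"
      using N by (simp add: negligible_iff_null_sets)
    obtain G where G: "open G" "N \<subseteq> G" "G - N \<in> lmeasurable"
        "emeasure lebesgue (G - N) < ennreal \<delta>"
      using sets_lebesgue_outer_open[of N \<delta>] Nl \<delta>(1) by blast
    \<comment> \<open>Outer regularity bounds \<open>G - N\<close>; putting the null set
      \<open>N\<close> back does not change the measure.\<close>
    have "G = (G - N) \<union> N" using G(2) by auto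
    then have "emeasure lebesgue G = emeasure lebesgue (G - N)"
      using emeasure_Un_null_set[of "G - N" lebesgue N] G(3) Nl by auto
    with G(3,4) have Gm: "G \<in> lmeasurable" "measure lebesgue G < \<delta>"
      using \<delta>(1) G(1) by (auto simp: fmeasurable_def measure_def ennreal_less_iff
          intro!: borel_open enn2real_less_iff[THEN iffD2])
    have "\<forall>x\<in>{a..b} - N. \<exists>d>0. \<forall>s t. s \<in> {a..b} \<longrightarrow> t \<in> {a..b} \<longrightarrow> s \<le> x \<longrightarrow> x \<le> t \<longrightarrow>
        {s, t} \<subseteq> ball x d \<longrightarrow> \<bar>(t - s) * f' x - (f t - f s)\<bar> \<le> e1 * (t - s)"
      using has_real_derivative_straddle[OF der e1(1)] by metis
    then obtain d where d: "\<And>x. x \<in> {a..b} - N \<Longrightarrow> d x > 0"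
      "\<And>x s t. x \<in> {a..b} - N \<Longrightarrow> s \<in> {a..b} \<Longrightarrow> t \<in> {a..b} \<Longrightarrow> s \<le> x \<Longrightarrow> x \<le> t \<Longrightarrow>
        {s, t} \<subseteq> ball x (d x) \<Longrightarrow> \<bar>(t - s) * f' x - (f t - f s)\<bar> \<le> e1 * (t - s)"
      by metis
    define \<gamma> where "\<gamma> x = (if x \<in> N then G else if x \<in> {a..b} then ball x (d x) else UNIV)" for x
    show "\<exists>\<gamma>. gauge \<gamma> \<and> (\<forall>D. D tagged_division_of {a..b} \<and> \<gamma> fine D \<longrightarrow>
        norm ((\<Sum>(x, K)\<in>D. measure lborel K *\<^sub>R F x) - (f b - f a)) < e)"
    proof (intro exI conjI allI impI; (elim conjE)?)
      show "gauge \<gamma>"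
        using G(1,2) d(1) by (auto simp: gauge_def \<gamma>_def)
      fix D assume D: "D tagged_division_of {a..b}" "\<gamma> fine D"
      define P where "P = {z \<in> D. fst z \<in> N}"
      have fin: "finite D" by (rule tagged_division_ofD(1)[OF D(1)])
      let ?\<Delta> = "\<lambda>K. f (Sup K) - f (Inf K)"
      let ?E = "\<lambda>(x, K). \<bar>measure lborel K * F x - ?\<Delta> K\<bar>"
      have P: "(\<Sum>z\<in>P. ?E z) < e / 2"
      proof -
        have "(\<Sum>(x, K)\<in>P. \<bar>?\<Delta> K\<bar>) < e / 2"
        proof (rule abs_cont_tagged_sum_less[OF D(1) _ Gm(1) _ Gm(2) \<delta>(2)])
          show "K \<subseteq> G" if "(x, K) \<in> P" for x K
            using that fineD[OF D(2)] by (fastforce simp: P_def \<gamma>_def)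
        qed (auto simp: P_def)
        moreover have "(\<Sum>z\<in>P. ?E z) = (\<Sum>(x, K)\<in>P. \<bar>?\<Delta> K\<bar>)"
          by (rule sum.cong) (auto simp: P_def F_def abs_minus_commute)
        ultimately show ?thesis by simp
      qed
      \<comment> \<open>Off \<open>N\<close> the straddle estimate bounds each error by
        \<open>e1\<close> times the cell length, and all lengths add up to
        \<open>b - a\<close>.\<close>
      have "(\<Sum>z\<in>D - P. ?E z) \<le> (\<Sum>z\<in>D - P. e1 * measure lborel (snd z))"
      proof (rule sum_mono)
        fix z assume "z \<in> D - P"
        then obtain x K where z: "z = (x, K)" "(x, K) \<in> D" "x \<notin> N"
          by (cases z) (auto simp: P_def)
        obtain s t where K: "K = {s..t}"
          using tagged_division_ofD(4)[OF D(1) z(2)] by auto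
        have x: "s \<le> x" "x \<le> t" "a \<le> s" "t \<le> b"
          using tagged_division_ofD(2,3)[OF D(1) z(2)] K by auto
        have "K \<subseteq> ball x (d x)"
          using fineD[OF D(2) z(2)] z(3) x by (auto simp: \<gamma>_def)
        moreover have "{s, t} \<subseteq> K" using x K by simp
        ultimately have "{s, t} \<subseteq> ball x (d x)" by (rule order_trans[rotated])
        then show "?E z \<le> e1 * measure lborel (snd z)"
          using d(2)[of x s t] x z(1,3) K by (simp add: F_def)
      qed
      also have "\<dots> \<le> (\<Sum>z\<in>D. e1 * measure lborel (snd z))"
        by (rule sum_mono2) (use fin e1 in auto)
      also have "\<dots> = e1 * (b - a)"
        using additive_content_tagged_division[of D a b] D(1) ab
        by (simp add: sum_distrib_left[symmetric] case_prod_unfold)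
      finally have Q: "(\<Sum>z\<in>D - P. ?E z) < e / 2" using e1(2) by simp
      \<comment> \<open>The increments of \<open>f\<close> telescope over the division, so the total
        error splits cell by cell.\<close>
      have "(\<Sum>(x, K)\<in>D. measure lborel K *\<^sub>R F x) - (f b - f a)
          = (\<Sum>(x, K)\<in>D. measure lborel K * F x - ?\<Delta> K)"
        unfolding additive_tagged_division_1[OF ab D(1), of f, symmetric]
        by (simp add: sum_subtractf case_prod_unfold)
      also have "norm \<dots> \<le> (\<Sum>z\<in>D. ?E z)"
        by (rule order_trans[OF norm_sum]) (simp add: case_prod_unfold)
      also have "\<dots> = (\<Sum>z\<in>D - P. ?E z) + (\<Sum>z\<in>P. ?E z)"
        by (rule sum.subset_diff) (use fin in \<open>auto simp: P_def\<close>)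
      also have "\<dots> < e" using P Q by simp
      finally show "norm ((\<Sum>(x, K)\<in>D. measure lborel K *\<^sub>R F x) - (f b - f a)) < e" .
    qed
  qed
  then show ?thesis
    by (rule has_integral_spike[OF N, rotated]) (simp add: F_def)
qed

section \<open>Closure of absolute continuity under differences and products\<close>

lemma abs_cont_on_dominated:
  assumes f: "abs_cont_on a b f" and g: "abs_cont_on a b g" and M: "M > 0"
    and le: "\<And>s t. s \<in> {a..b} \<Longrightarrow> t \<in> {a..b} \<Longrightarrow> \<bar>h t - h s\<bar> \<le> M * (\<bar>f t - f s\<bar> + \<bar>g t - g s\<bar>)"
  shows "abs_cont_on a b h"
  unfolding abs_cont_on_def
proof (intro allI impI)
  fix e :: real assume e: "e > 0"
  \<comment> \<open>Each of \<open>f\<close> and \<open>g\<close> gets the tolerance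
    \<open>e / (2 * M)\<close>, so that the factor \<open>M\<close> restores
    \<open>e\<close>.\<close>
  then have e': "e / (2 * M) > 0" using M by simp
  obtain d1 where d1: "d1 > 0" "\<And>I. finite I \<Longrightarrow> \<forall>(s, t)\<in>I. a \<le> s \<and> s \<le> t \<and> t \<le> b \<Longrightarrow>
        pairwise (\<lambda>(s, t) (s', t'). disjnt {s<..<t} {s'<..<t'}) I \<Longrightarrow>
        (\<Sum>(s, t)\<in>I. t - s) < d1 \<Longrightarrow> (\<Sum>(s, t)\<in>I. \<bar>f t - f s\<bar>) < e / (2 * M)"
    using f[unfolded abs_cont_on_def, rule_format, OF e'] by blast
  obtain d2 where d2: "d2 > 0" "\<And>I. finite I \<Longrightarrow> \<forall>(s, t)\<in>I. a \<le> s \<and> s \<le> t \<and> t \<le> b \<Longrightarrow>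
        pairwise (\<lambda>(s, t) (s', t'). disjnt {s<..<t} {s'<..<t'}) I \<Longrightarrow>
        (\<Sum>(s, t)\<in>I. t - s) < d2 \<Longrightarrow> (\<Sum>(s, t)\<in>I. \<bar>g t - g s\<bar>) < e / (2 * M)"
    using g[unfolded abs_cont_on_def, rule_format, OF e'] by blast
  show "\<exists>d>0. \<forall>I. finite I \<longrightarrow> (\<forall>(s, t)\<in>I. a \<le> s \<and> s \<le> t \<and> t \<le> b) \<longrightarrow>
        pairwise (\<lambda>(s, t) (s', t'). disjnt {s<..<t} {s'<..<t'}) I \<longrightarrow>
        (\<Sum>(s, t)\<in>I. t - s) < d \<longrightarrow> (\<Sum>(s, t)\<in>I. \<bar>h t - h s\<bar>) < e"
  proof (intro exI[of _ "min d1 d2"] conjI allI impI)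
    fix I :: "(real \<times> real) set"
    assume I: "finite I" "\<forall>(s, t)\<in>I. a \<le> s \<and> s \<le> t \<and> t \<le> b"
      "pairwise (\<lambda>(s, t) (s', t'). disjnt {s<..<t} {s'<..<t'}) I"
      "(\<Sum>(s, t)\<in>I. t - s) < min d1 d2"
    have "(\<Sum>(s, t)\<in>I. \<bar>h t - h s\<bar>) \<le> (\<Sum>(s, t)\<in>I. M * (\<bar>f t - f s\<bar> + \<bar>g t - g s\<bar>))"
      using I(2) by (intro sum_mono) (auto intro!: le)
    also have "\<dots> = M * ((\<Sum>(s, t)\<in>I. \<bar>f t - f s\<bar>) + (\<Sum>(s, t)\<in>I. \<bar>g t - g s\<bar>))"
      by (simp add: sum_distrib_left[symmetric] sum.distrib case_prod_unfold)
    also have "\<dots> < M * (e / (2 * M) + e / (2 * M))"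
      using d1(2)[OF I(1-3)] d2(2)[OF I(1-3)] I(4) M by (intro mult_strict_left_mono add_strict_mono) auto
    also have "\<dots> = e" using M by (simp add: field_simps)
    finally show "(\<Sum>(s, t)\<in>I. \<bar>h t - h s\<bar>) < e" .
  qed (use d1(1) d2(1) in simp)
qed

lemma abs_cont_on_diff:
  assumes "abs_cont_on a b f" "abs_cont_on a b g"
  shows "abs_cont_on a b (\<lambda>x. f x - g x)"
  by (rule abs_cont_on_dominated[OF assms, of 1]) auto

lemma abs_cont_on_mult:
  assumes f: "abs_cont_on a b f" and g: "abs_cont_on a b g"
  shows "abs_cont_on a b (\<lambda>x. f x * g x)"
proof -
  have "\<exists>M. \<forall>x\<in>{a..b}. \<bar>h x\<bar> \<le> M" if "abs_cont_on a b h" for h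
    using compact_imp_bounded[OF compact_continuous_image[OF abs_cont_on_imp_continuous_on[OF that]]]
    by (auto simp: bounded_iff)
  then obtain M1 M2 where M1: "\<And>x. x \<in> {a..b} \<Longrightarrow> \<bar>f x\<bar> \<le> M1"
    and M2: "\<And>x. x \<in> {a..b} \<Longrightarrow> \<bar>g x\<bar> \<le> M2"
    using f g by metis
  \<comment> \<open>Bounds both factors on the compact interval; the summand 1 keeps it
    positive.\<close>
  define M where "M = \<bar>M1\<bar> + \<bar>M2\<bar> + 1"
  show ?thesis
  proof (rule abs_cont_on_dominated[OF f g, of M])
    fix s t assume st: "s \<in> {a..b}" "t \<in> {a..b}"
    have "\<bar>f t * g t - f s * g s\<bar> = \<bar>g t * (f t - f s) + f s * (g t - g s)\<bar>"
      by (simp add: algebra_simps)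
    also have "\<dots> \<le> \<bar>g t\<bar> * \<bar>f t - f s\<bar> + \<bar>f s\<bar> * \<bar>g t - g s\<bar>"
      by (metis abs_mult abs_triangle_ineq)
    also have "\<dots> \<le> M * \<bar>f t - f s\<bar> + M * \<bar>g t - g s\<bar>"
      using M1[OF st(1)] M2[OF st(2)] by (intro add_mono mult_right_mono) (auto simp: M_def)
    finally show "\<bar>f t * g t - f s * g s\<bar> \<le> M * (\<bar>f t - f s\<bar> + \<bar>g t - g s\<bar>)"
      by (simp add: distrib_left)
  qed (simp add: M_def)
qed

section \<open>Weak derivatives and the domain of the error operator\<close>

lemma has_l2_deriv_diff:
  assumes "has_l2_deriv u u'" "has_l2_deriv v v'"
  shows "has_l2_deriv (u - v) (u' - v')"
proof -
  obtain f f' g g' where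
    f: "abs_cont_on 0 1 f" "sq_integrable f" "u = abs_l2 f" "sq_integrable f'" "u' = abs_l2 f'"
       "AE x in unit_measure. (f has_real_derivative f' x) (at x)" and
    g: "abs_cont_on 0 1 g" "sq_integrable g" "v = abs_l2 g" "sq_integrable g'" "v' = abs_l2 g'"
       "AE x in unit_measure. (g has_real_derivative g' x) (at x)"
    using assms unfolding has_l2_deriv_def by blast
  have "AE x in unit_measure. ((\<lambda>x. f x - g x) has_real_derivative f' x - g' x) (at x)"
    using f(6) g(6) by eventually_elim (rule DERIV_diff)
  then show ?thesis
    unfolding has_l2_deriv_def f(3,5) g(3,5)
    by (intro exI[of _ "\<lambda>x. f x - g x"] exI[of _ "\<lambda>x. f' x - g' x"] conjI
        abs_cont_on_diff abs_l2_diff f g)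
qed

lemma point_value_diff:
  assumes "has_l2_deriv u u'" "has_l2_deriv v v'" "x \<in> {0..1}"
  shows "point_value (u - v) x = point_value u x - point_value v x"
proof -
  obtain f g where fg: "abs_cont_on 0 1 f" "sq_integrable f" "u = abs_l2 f"
      "abs_cont_on 0 1 g" "sq_integrable g" "v = abs_l2 g"
    using assms unfolding has_l2_deriv_def by blast
  show ?thesis
    unfolding fg(3,6) abs_l2_diff(2)[OF fg(2,5)]
    using point_value_eq[OF abs_cont_on_diff[OF fg(1,4)] abs_l2_diff(1)[OF fg(2,5)] assms(3)]
      point_value_eq[OF fg(1,2) assms(3)] point_value_eq[OF fg(4,5) assms(3)]
    by simp
qed

text \<open>The product of the absolutely continuous representatives is absolutely continuous and
  obeys the product rule almost everywhere, so the fundamental theorem above applies to it.\<close>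

lemma l2_integration_by_parts:
  assumes "has_l2_deriv u u'" "has_l2_deriv v v'"
  shows "inner u' v + inner u v' = point_value u 1 * point_value v 1 - point_value u 0 * point_value v 0"
proof -
  obtain f f' g g' where
    f: "abs_cont_on 0 1 f" "sq_integrable f" "u = abs_l2 f" "sq_integrable f'" "u' = abs_l2 f'"
       "AE x in unit_measure. (f has_real_derivative f' x) (at x)" and
    g: "abs_cont_on 0 1 g" "sq_integrable g" "v = abs_l2 g" "sq_integrable g'" "v' = abs_l2 g'"
       "AE x in unit_measure. (g has_real_derivative g' x) (at x)"
    using assms unfolding has_l2_deriv_def by blast
  let ?d = "\<lambda>x. f' x * g x + f x * g' x"
  have "AE x in unit_measure. ((\<lambda>x. f x * g x) has_real_derivative ?d x) (at x)"
    using f(6) g(6) by eventually_elim (rule DERIV_mult'[THEN DERIV_cong], auto)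
  then have "AE x in lebesgue. x \<in> {0<..<1} \<longrightarrow> ((\<lambda>x. f x * g x) has_real_derivative ?d x) (at x)"
    by (simp add: AE_restrict_space_iff)
  then obtain N where N: "N \<in> null_sets lebesgue"
    "\<And>x. x \<in> {0<..<1} - N \<Longrightarrow> ((\<lambda>x. f x * g x) has_real_derivative ?d x) (at x)"
    by (auto simp: eventually_ae_filter)
  have "(?d has_integral f 1 * g 1 - f 0 * g 0) {0..1}"
  proof (rule fundamental_theorem_of_calculus_abs_cont)
    \<comment> \<open>The almost-everywhere statement concerns the open interval, so the endpoints
      join the exceptional set.\<close>
    show "negligible (N \<union> {0, 1})"
      using N(1) by (simp add: negligible_iff_null_sets[symmetric])
    show "((\<lambda>x. f x * g x) has_real_derivative ?d x) (at x within {0..1})"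
      if "x \<in> {0..1} - (N \<union> {0, 1})" for x
      by (rule has_field_derivative_at_within[OF N(2)]) (use that in auto)
  qed (use abs_cont_on_mult[OF f(1) g(1)] in auto)
  moreover have int: "integrable unit_measure (\<lambda>x. f' x * g x)" "integrable unit_measure (\<lambda>x. f x * g' x)"
    using f g by (auto intro: sq_integrable_mult)
  then have "(?d has_integral (\<integral>x. ?d x \<partial>unit_measure)) {0<..<1}"
    by (intro has_integral_integral_lebesgue_on Bochner_Integration.integrable_add) auto
  then have "(?d has_integral (\<integral>x. ?d x \<partial>unit_measure)) {0..1}"
    by (simp add: has_integral_Icc_iff_Ioo)
  ultimately have "(\<integral>x. ?d x \<partial>unit_measure) = f 1 * g 1 - f 0 * g 0"
    using has_integral_unique by blast
  moreover have "(\<integral>x. ?d x \<partial>unit_measure) = inner u' v + inner u v'"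
    using int f g by (simp add: inner_l2.abs_eq l2_rel_refl)
  ultimately show ?thesis
    using f(1-3) g(1-3) by (simp add: point_value_eq)
qed

text \<open>Pairing with this unit vector gives the mean over the interval; by parts, a second
  derivative paired with it gives the boundary flux.\<close>

definition one_l2 :: l2 where "one_l2 = abs_l2 (\<lambda>x. 1)"

lemma sq_integrable_one: "sq_integrable (\<lambda>x. 1)"
  unfolding sq_integrable_def
  by (intro conjI borel_measurable_const finite_measure.integrable_const
      finite_measure_lebesgue_on) simp

lemma abs_cont_on_const: "abs_cont_on a b (\<lambda>x. c)"
  unfolding abs_cont_on_def
proof (intro allI impI)
  fix \<epsilon> :: real assume "\<epsilon> > 0"
  then have "(\<Sum>(s, t)\<in>I. \<bar>c - c\<bar>) < \<epsilon>" for I :: "(real \<times> real) set"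
    by (simp add: case_prod_unfold)
  then show "\<exists>\<delta>>0. \<forall>I. finite I \<longrightarrow> (\<forall>(s, t)\<in>I. a \<le> s \<and> s \<le> t \<and> t \<le> b) \<longrightarrow>
        pairwise (\<lambda>(s, t) (s', t'). disjnt {s<..<t} {s'<..<t'}) I \<longrightarrow>
        (\<Sum>(s, t)\<in>I. t - s) < \<delta> \<longrightarrow> (\<Sum>(s, t)\<in>I. \<bar>c - c\<bar>) < \<epsilon>"
    by (intro exI[of _ 1]) auto
qed

lemma has_l2_deriv_one_l2: "has_l2_deriv one_l2 0"
  unfolding has_l2_deriv_def one_l2_def zero_l2.abs_eq
  by (intro exI[of _ "\<lambda>x. 1"] exI[of _ "\<lambda>x. 0"] conjI refl AE_I2 DERIV_const
      abs_cont_on_const sq_integrable_one sq_integrable_zero)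

lemma point_value_one_l2: "x \<in> {0..1} \<Longrightarrow> point_value one_l2 x = 1"
  unfolding one_l2_def by (rule point_value_eq[OF abs_cont_on_const sq_integrable_one])

lemma norm_one_l2: "norm one_l2 = 1"
proof -
  have "(norm one_l2)\<^sup>2 = 1\<^sup>2"
    unfolding one_l2_def norm_abs_l2_sq[OF sq_integrable_one] by (simp add: measure_restrict_space)
  then show ?thesis by (rule power2_eq_imp_eq) simp_all
qed

section \<open>The error operator on its domain\<close>

lemma dom_A_e_cases:
  assumes "(u, c) \<in> dom_A_e gam"
  obtains v w where "has_l2_deriv u v" "has_l2_deriv v w" "point_value v 0 = 0"
    "point_value v 1 = - gam * point_value u 1 + c"
    "A_e lam k rho (u, c) = (lam *\<^sub>R w - k *\<^sub>R u, - rho * point_value u 1)"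
proof -
  obtain v w where "has_l2_deriv u v" "has_l2_deriv v w"
    using assms by (auto simp: dom_A_e_def H2_def)
  with assms show ?thesis
    by (intro that[of v w]) (auto simp: dom_A_e_def A_e_def l2_deriv_eq)
qed

text \<open>Weak derivatives and point values respect differences, and the boundary conditions are
  homogeneous. This is the form of linearity that increments of the primitive call for.\<close>

lemma A_e_diff:
  assumes "z \<in> dom_A_e gam" "z' \<in> dom_A_e gam"
  shows "z - z' \<in> dom_A_e gam" "A_e lam k rho (z - z') = A_e lam k rho z - A_e lam k rho z'"
proof -
  obtain u c u' c' where z: "z = (u, c)" "z' = (u', c')" by (cases z, cases z')
  obtain v w where u: "has_l2_deriv u v" "has_l2_deriv v w" "point_value v 0 = 0"
      "point_value v 1 = - gam * point_value u 1 + c"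
      "A_e lam k rho (u, c) = (lam *\<^sub>R w - k *\<^sub>R u, - rho * point_value u 1)"
    using assms(1) dom_A_e_cases unfolding z by blast
  obtain v' w' where u': "has_l2_deriv u' v'" "has_l2_deriv v' w'" "point_value v' 0 = 0"
      "point_value v' 1 = - gam * point_value u' 1 + c'"
      "A_e lam k rho (u', c') = (lam *\<^sub>R w' - k *\<^sub>R u', - rho * point_value u' 1)"
    using assms(2) dom_A_e_cases unfolding z by blast
  note d = has_l2_deriv_diff[OF u(1) u'(1)] has_l2_deriv_diff[OF u(2) u'(2)]
  note pv = point_value_diff[OF u(1) u'(1)] point_value_diff[OF u(2) u'(2)]
  show "z - z' \<in> dom_A_e gam"
    using d u u' by (auto simp: z dom_A_e_def H2_def l2_deriv_eq[OF d(1)] pv algebra_simps)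
  show "A_e lam k rho (z - z') = A_e lam k rho z - A_e lam k rho z'"
    unfolding z u(5) u'(5)
    by (simp add: A_e_def l2_deriv_eq[OF d(1)] l2_deriv_eq[OF d(2)] pv algebra_simps)
qed

section \<open>The Lyapunov function\<close>

text \<open>The energy alone only dissipates the \<^typ>\<open>l2\<close>-component; its cross term with the mean
  of \<open>u\<close> produces the missing negative multiple of \<open>c\<^sup>2\<close>.\<close>

definition lyap :: "real \<Rightarrow> real \<Rightarrow> real \<Rightarrow> l2 \<times> real \<Rightarrow> real" where
  "lyap lam rho \<epsilon> = (\<lambda>(u, c). inner u u / 2 + lam / (2 * rho) * c\<^sup>2 - \<epsilon> * (c * inner u one_l2))"

text \<open>The differential of the quadratic form \<open>lyap\<close> at the first argument, in the
  direction of the second.\<close>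

definition lyap_deriv :: "real \<Rightarrow> real \<Rightarrow> real \<Rightarrow> l2 \<times> real \<Rightarrow> l2 \<times> real \<Rightarrow> real" where
  "lyap_deriv lam rho \<epsilon> = (\<lambda>(u, c) (u', c').
     inner u u' + lam / rho * (c * c') - \<epsilon> * (c' * inner u one_l2 + c * inner u' one_l2))"

text \<open>Homogeneity of degree two carries a decay inequality from increments to difference
  quotients.\<close>

lemma lyap_scaleR: "lyap lam rho \<epsilon> (r *\<^sub>R z) = r\<^sup>2 * lyap lam rho \<epsilon> z"
  by (cases z) (simp add: lyap_def power2_eq_square algebra_simps)

lemma continuous_on_lyap: "continuous_on UNIV (lyap lam rho \<epsilon>)"
  unfolding lyap_def case_prod_unfold by (intro continuous_intros) simp

lemma lyap_has_derivative:
  assumes "(z has_vector_derivative z') (at t)"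
  shows "((\<lambda>t. lyap lam rho \<epsilon> (z t)) has_real_derivative lyap_deriv lam rho \<epsilon> (z t) z') (at t)"
proof -
  have u: "((\<lambda>t. fst (z t)) has_vector_derivative fst z') (at t)"
    by (rule bounded_linear.has_vector_derivative[OF bounded_linear_fst assms])
  have "((\<lambda>t. snd (z t)) has_vector_derivative snd z') (at t)"
    by (rule bounded_linear.has_vector_derivative[OF bounded_linear_snd assms])
  then have c: "((\<lambda>t. snd (z t)) has_real_derivative snd z') (at t)"
    by (simp add: has_real_derivative_iff_has_vector_derivative)
  note inner = bounded_bilinear.has_vector_derivative[OF bounded_bilinear_inner,
      folded has_real_derivative_iff_has_vector_derivative]
  have uu: "((\<lambda>t. inner (fst (z t)) (fst (z t))) has_real_derivative 2 * inner (fst (z t)) (fst z')) (at t)"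
    using inner[OF u u] by (simp add: inner_commute)
  have u1: "((\<lambda>t. inner (fst (z t)) one_l2) has_real_derivative inner (fst z') one_l2) (at t)"
    using inner[OF u has_vector_derivative_const] by simp
  show ?thesis
    unfolding lyap_def lyap_deriv_def case_prod_unfold
    by (rule DERIV_cong[OF DERIV_diff[OF DERIV_add[OF DERIV_cdivide[OF uu]
          DERIV_cmult[OF DERIV_power[OF c]]] DERIV_cmult[OF DERIV_mult[OF c u1]]]])
      (simp add: algebra_simps)
qed

text \<open>The first two smallness bounds keep \<open>lyap\<close> comparable with the energy. The
  last two let the dissipation absorb what the cross term contributes through the boundary value
  \<open>u(1)\<close> and the mean of \<open>u\<close>.\<close>

locale small_coupling =
  fixes lam k rho gam \<epsilon> :: real
  assumes pos: "lam > 0" "k > 0" "rho > 0" "gam > 0" "\<epsilon> > 0"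
    and small: "\<epsilon> \<le> 1 / 2" "\<epsilon> \<le> lam / (2 * rho)"
      "\<epsilon> * (lam * gam\<^sup>2 + rho / 2) \<le> lam * gam" "\<epsilon> * (k\<^sup>2 / lam + rho / 2) \<le> k / 2"
begin

text \<open>Cauchy-Schwarz against a unit vector, then Young's inequality; the bound is half of the
  energy.\<close>

lemma cross_term_le:
  "\<bar>\<epsilon> * (c * inner u one_l2)\<bar> \<le> inner u u / 4 + lam / (4 * rho) * c\<^sup>2"
proof -
  have P: "\<bar>inner u one_l2\<bar> \<le> norm u"
    using Cauchy_Schwarz_ineq2[of u one_l2] by (simp add: norm_one_l2)
  have "\<bar>c * inner u one_l2\<bar> \<le> \<bar>c\<bar> * norm u"
    unfolding abs_mult by (rule mult_left_mono[OF P]) simp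
  also have "\<dots> \<le> (c\<^sup>2 + inner u u) / 2"
    using sum_squares_bound[of "\<bar>c\<bar>" "norm u"] by (simp add: power2_norm_eq_inner)
  finally have "\<epsilon> * \<bar>c * inner u one_l2\<bar> \<le> \<epsilon> * ((c\<^sup>2 + inner u u) / 2)"
    using pos(5) by (intro mult_left_mono) auto
  also have "\<dots> = \<epsilon> * c\<^sup>2 / 2 + \<epsilon> * inner u u / 2"
    by (simp add: field_simps)
  also have "\<dots> \<le> lam / (2 * rho) * c\<^sup>2 / 2 + 1 / 2 * inner u u / 2"
    using small(1,2) by (intro add_mono divide_right_mono mult_right_mono) auto
  finally show ?thesis
    using pos(5) by (simp add: abs_mult)
qed

text \<open>Since the cross term is at most half of the energy, \<open>lyap\<close> lies between one
  half and three halves of it.\<close>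

lemma lyap_ge: "inner u u / 4 + lam / (4 * rho) * c\<^sup>2 \<le> lyap lam rho \<epsilon> (u, c)"
  and lyap_le: "lyap lam rho \<epsilon> (u, c) \<le> 3 / 4 * inner u u + 3 / 4 * (lam / rho) * c\<^sup>2"
proof -
  have "lam / (2 * rho) * c\<^sup>2 = 2 * (lam / (4 * rho) * c\<^sup>2)"
    "3 / 4 * (lam / rho) * c\<^sup>2 = 3 * (lam / (4 * rho) * c\<^sup>2)" by simp_all
  then show "inner u u / 4 + lam / (4 * rho) * c\<^sup>2 \<le> lyap lam rho \<epsilon> (u, c)"
    "lyap lam rho \<epsilon> (u, c) \<le> 3 / 4 * inner u u + 3 / 4 * (lam / rho) * c\<^sup>2"
    using cross_term_le[of c u] unfolding lyap_def prod.case by linarith+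
qed

text \<open>The smaller of the two ratios between the dissipation coefficients \<open>k / 2\<close>,
  \<open>\<epsilon> * lam / 2\<close> and the coefficients \<open>3 / 4\<close>,
  \<open>3 / 4 * (lam / rho)\<close> in \<open>lyap_le\<close>.\<close>

definition decay_rate :: real where
  "decay_rate = min (2 * k / 3) (2 * \<epsilon> * rho / 3)"

lemma decay_rate_pos: "decay_rate > 0"
  using pos by (simp add: decay_rate_def)

text \<open>Integration by parts with the boundary conditions yields dissipation in
  \<open>u\<close>, its derivative and \<open>u(1)\<close>; the cross term adds
  \<open>- \<epsilon> * lam * c\<^sup>2\<close> and mixed terms, which Young's inequality
  absorbs.\<close>

lemma lyap_deriv_A_e_le:
  assumes "z \<in> dom_A_e gam"
  shows "lyap_deriv lam rho \<epsilon> z (A_e lam k rho z) \<le> - decay_rate * lyap lam rho \<epsilon> z"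
proof -
  obtain u c where z: "z = (u, c)" by (cases z)
  obtain v w where u: "has_l2_deriv u v" "has_l2_deriv v w" "point_value v 0 = 0"
      "point_value v 1 = - gam * point_value u 1 + c"
      "A_e lam k rho (u, c) = (lam *\<^sub>R w - k *\<^sub>R u, - rho * point_value u 1)"
    using assms dom_A_e_cases unfolding z by blast
  define p where "p = point_value u 1"
  define P where "P = inner u one_l2"
  define S where "S = inner u u"
  define q where "q = - gam * p + c"
  \<comment> \<open>The Neumann condition at 0 removes the left boundary term.\<close>
  have wu: "inner u w = q * p - inner v v"
    using l2_integration_by_parts[OF u(2,1)] u(3,4) by (simp add: q_def p_def inner_commute)
  have w1: "inner w one_l2 = q"
    using l2_integration_by_parts[OF u(2) has_l2_deriv_one_l2] u(3,4)
    by (simp add: q_def p_def point_value_one_l2)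
  have "\<bar>P\<bar> \<le> norm u"
    using Cauchy_Schwarz_ineq2[of u one_l2] by (simp add: P_def norm_one_l2)
  then have PS: "P\<^sup>2 \<le> S"
    unfolding S_def power2_norm_eq_inner[symmetric] by (metis abs_le_square_iff abs_norm_cancel)
  \<comment> \<open>The boundary product \<open>lam * (p * c)\<close> cancels against the
    integrator's contribution: this is what the weight \<open>lam / rho\<close> achieves.\<close>
  have E: "lyap_deriv lam rho \<epsilon> z (A_e lam k rho z)
      = - (lam * gam * p\<^sup>2) - lam * inner v v - k * S - \<epsilon> * lam * c\<^sup>2
        + \<epsilon> * (rho * (p * P) + lam * gam * (p * c) + k * (c * P))"
    using pos(3) unfolding z u(5) lyap_deriv_def prod.case p_def[symmetric] P_def[symmetric]
      inner_diff_right inner_diff_left inner_scaleR_right inner_scaleR_left wu w1 S_def[symmetric]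
    by (simp add: q_def power2_eq_square field_simps)
  \<comment> \<open>The Young weights are chosen so that \<open>c\<^sup>2\<close> receives
    \<open>lam / 4\<close> twice, which uses up half of the gain
    \<open>lam * c\<^sup>2\<close>.\<close>
  have b1: "rho * (p * P) \<le> rho / 2 * p\<^sup>2 + rho / 2 * P\<^sup>2"
    using mult_left_mono[OF sum_squares_bound[of p P], of "rho / 2"] pos(3) by (simp add: algebra_simps)
  have b2: "lam * gam * (p * c) \<le> lam * c\<^sup>2 / 4 + lam * gam\<^sup>2 * p\<^sup>2"
    using mult_left_mono[OF sum_squares_bound[of "gam * p" "c / 2"], of lam] pos(1)
    by (simp add: algebra_simps power_mult_distrib power_divide)
  have b3: "k * (c * P) \<le> lam * c\<^sup>2 / 4 + k\<^sup>2 / lam * P\<^sup>2"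
  proof -
    have "k * (c * P) = lam * (2 * (k * P / lam) * (c / 2))"
      using pos(1) by simp
    also have "\<dots> \<le> lam * ((k * P / lam)\<^sup>2 + (c / 2)\<^sup>2)"
      by (rule mult_left_mono[OF sum_squares_bound]) (use pos(1) in simp)
    also have "\<dots> = lam * c\<^sup>2 / 4 + k\<^sup>2 / lam * P\<^sup>2"
      using pos(1) by (simp add: power2_eq_square field_simps)
    finally show ?thesis .
  qed
  have "rho * (p * P) + lam * gam * (p * c) + k * (c * P)
      \<le> lam / 2 * c\<^sup>2 + (lam * gam\<^sup>2 + rho / 2) * p\<^sup>2 + (k\<^sup>2 / lam + rho / 2) * P\<^sup>2"
    using b1 b2 b3 by (simp add: distrib_right)
  then have "\<epsilon> * (rho * (p * P) + lam * gam * (p * c) + k * (c * P))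
      \<le> \<epsilon> * (lam / 2 * c\<^sup>2 + (lam * gam\<^sup>2 + rho / 2) * p\<^sup>2 + (k\<^sup>2 / lam + rho / 2) * P\<^sup>2)"
    by (rule mult_left_mono) (use pos in simp)
  also have "\<dots> = \<epsilon> * lam / 2 * c\<^sup>2 + \<epsilon> * (lam * gam\<^sup>2 + rho / 2) * p\<^sup>2
      + \<epsilon> * (k\<^sup>2 / lam + rho / 2) * P\<^sup>2"
    by (simp add: algebra_simps)
  \<comment> \<open>The \<open>p\<^sup>2\<close> term is matched with the boundary dissipation, and
    \<open>P\<^sup>2 \<le> S\<close> lets half of \<open>k * S\<close> cover the mean.\<close>
  also have "\<dots> \<le> \<epsilon> * lam / 2 * c\<^sup>2 + lam * gam * p\<^sup>2 + k / 2 * S"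
    using small(3,4) pos PS by (intro add_mono[OF add_mono[OF order_refl mult_right_mono] mult_mono]) auto
  finally have "lyap_deriv lam rho \<epsilon> z (A_e lam k rho z) \<le> - (k / 2 * S) - \<epsilon> * lam / 2 * c\<^sup>2 - lam * inner v v"
    unfolding E by simp
  also have "\<dots> \<le> - (k / 2 * S + \<epsilon> * lam / 2 * c\<^sup>2)"
    using pos(1) by simp
  also have "k / 2 * S + \<epsilon> * lam / 2 * c\<^sup>2 \<ge> decay_rate * (3 / 4 * S + 3 / 4 * (lam / rho) * c\<^sup>2)"
  proof -
    have "decay_rate * (3 / 4 * S) \<le> 2 * k / 3 * (3 / 4 * S)"
      by (rule mult_right_mono) (simp_all add: decay_rate_def S_def)
    moreover have "decay_rate * (3 / 4 * (lam / rho) * c\<^sup>2) \<le> 2 * \<epsilon> * rho / 3 * (3 / 4 * (lam / rho) * c\<^sup>2)"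
      by (rule mult_right_mono) (use pos in \<open>simp_all add: decay_rate_def\<close>)
    moreover have "2 * k / 3 * (3 / 4 * S) = k / 2 * S"
      "2 * \<epsilon> * rho / 3 * (3 / 4 * (lam / rho) * c\<^sup>2) = \<epsilon> * lam / 2 * c\<^sup>2"
      using pos(3) by simp_all
    ultimately show ?thesis unfolding distrib_left by linarith
  qed
  then have "- (k / 2 * S + \<epsilon> * lam / 2 * c\<^sup>2) \<le> - (decay_rate * (3 / 4 * S + 3 / 4 * (lam / rho) * c\<^sup>2))"
    by simp
  also have "\<dots> \<le> - decay_rate * lyap lam rho \<epsilon> z"
    using mult_left_mono[OF lyap_le[of u c], of decay_rate] decay_rate_pos
    by (simp add: z S_def)
  finally show ?thesis .
qed

section \<open>Exponential decay along classical and mild solutions\<close>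

lemma lyap_classical_decay:
  assumes cont: "continuous_on {0..} z"
    and der: "\<And>t. t > 0 \<Longrightarrow> (z has_vector_derivative A_e lam k rho (z t)) (at t)"
    and dom: "\<And>t. t > 0 \<Longrightarrow> z t \<in> dom_A_e gam"
    and t: "t \<ge> 0"
  shows "lyap lam rho \<epsilon> (z t) \<le> exp (- decay_rate * t) * lyap lam rho \<epsilon> (z 0)"
proof -
  \<comment> \<open>Integrating factor: the differential inequality makes \<open>?f\<close>
    nonincreasing at positive times, and continuity takes the comparison down to time 0.\<close>
  let ?f = "\<lambda>t. exp (decay_rate * t) * lyap lam rho \<epsilon> (z t)"
  have "?f t \<le> ?f 0"
  proof (rule DERIV_nonpos_imp_decreasing_open[OF t])
    fix s assume s: "0 < s" "s < t"
    let ?d = "lyap_deriv lam rho \<epsilon> (z s) (A_e lam k rho (z s))"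
    have "(?f has_real_derivative exp (decay_rate * s) * (?d + decay_rate * lyap lam rho \<epsilon> (z s))) (at s)"
      by (rule derivative_eq_intros lyap_has_derivative der s refl)+ (simp add: algebra_simps)
    moreover have "exp (decay_rate * s) * (?d + decay_rate * lyap lam rho \<epsilon> (z s)) \<le> 0"
      using lyap_deriv_A_e_le[OF dom[OF s(1)]] by (intro mult_nonneg_nonpos) auto
    ultimately show "\<exists>y. (?f has_real_derivative y) (at s) \<and> y \<le> 0" by blast
  next
    show "continuous_on {0..t} ?f"
      by (intro continuous_intros continuous_on_compose2[OF continuous_on_lyap]
          continuous_on_subset[OF cont]) auto
  qed
  then show ?thesis by (simp add: exp_minus field_simps)
qed

lemma lyap_mild_decay:
  assumes "is_solution (A_e lam k rho) (dom_A_e gam) \<infinity> \<phi>" and t: "t \<ge> 0"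
  shows "lyap lam rho \<epsilon> (\<phi> t) \<le> exp (- decay_rate * t) * lyap lam rho \<epsilon> (\<phi> 0)"
proof -
  define \<Phi> where "\<Phi> t = integral {0..t} \<phi>" for t
  have cont: "continuous_on {0..} \<phi>"
    and dom: "\<And>t. t \<ge> 0 \<Longrightarrow> \<Phi> t \<in> dom_A_e gam"
    and eq: "\<And>t. t \<ge> 0 \<Longrightarrow> \<phi> t = \<phi> 0 + A_e lam k rho (\<Phi> t)"
  proof -
    note sol = assms(1)[unfolded is_solution_def, THEN conjunct2]
    show "continuous_on {0..} \<phi>"
      using sol[THEN conjunct1] by (simp add: atLeast_def)
    show "\<Phi> t \<in> dom_A_e gam" "\<phi> t = \<phi> 0 + A_e lam k rho (\<Phi> t)" if "t \<ge> 0" for t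
      using sol[THEN conjunct2, THEN spec[of _ t]] that unfolding \<Phi>_def by simp_all
  qed
  have der_within: "(\<Phi> has_vector_derivative \<phi> t) (at t within {0..b})" if "0 \<le> t" "t \<le> b" for t b
    unfolding \<Phi>_def
    by (rule integral_has_vector_derivative) (use that cont in \<open>auto intro: continuous_on_subset\<close>)
  have der: "(\<Phi> has_vector_derivative \<phi> t) (at t)" if "t > 0" for t
    using der_within[of t "t + 1"] that by (simp add: at_within_Icc_at)
  have cont_\<Phi>: "continuous_on {0..} \<Phi>"
    unfolding continuous_on_eq_continuous_within
  proof
    fix t :: real assume "t \<in> {0..}"
    then have "continuous (at t within {0..t + 1}) \<Phi>"
      using der_within[of t "t + 1"] by (intro has_vector_derivative_continuous) auto
    moreover have "at t within {0..t + 1} = at t within {0..}"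
      by (rule at_within_nhd[of _ "{..<t + 1}"]) auto
    ultimately show "continuous (at t within {0..}) \<Phi>" by simp
  qed
  \<comment> \<open>Decay of the increment over the lag \<open>h\<close>, multiplied by
    \<open>(1 / h)\<^sup>2\<close>; writing \<open>h + 0\<close> makes the right-hand side match the
    limit below at time 0.\<close>
  have step: "lyap lam rho \<epsilon> ((1 / h) *\<^sub>R (\<Phi> (h + t) - \<Phi> t))
      \<le> exp (- decay_rate * t) * lyap lam rho \<epsilon> ((1 / h) *\<^sub>R (\<Phi> (h + 0) - \<Phi> 0))" if h: "h > 0" for h
  proof -
    have "lyap lam rho \<epsilon> (\<Phi> (h + t) - \<Phi> t) \<le> exp (- decay_rate * t) * lyap lam rho \<epsilon> (\<Phi> (h + 0) - \<Phi> 0)"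
    proof (rule lyap_classical_decay[OF _ _ _ t])
      show "continuous_on {0..} (\<lambda>t. \<Phi> (h + t) - \<Phi> t)"
        by (intro continuous_intros cont_\<Phi> continuous_on_compose2[OF cont_\<Phi>]) (use h in auto)
    next
      fix s :: real assume s: "s > 0"
      show "\<Phi> (h + s) - \<Phi> s \<in> dom_A_e gam"
        using s h by (intro A_e_diff dom) auto
      have "((\<lambda>s. \<Phi> (h + s)) has_vector_derivative \<phi> (h + s)) (at s)"
      proof -
        have "((\<lambda>s. h + s) has_vector_derivative 1) (at s)"
          by (auto intro: derivative_eq_intros simp: has_real_derivative_iff_has_vector_derivative[symmetric])
        from vector_diff_chain_at[OF this der] show ?thesis
          using s h by (simp add: o_def)
      qed
      then have "((\<lambda>s. \<Phi> (h + s) - \<Phi> s) has_vector_derivative \<phi> (h + s) - \<phi> s) (at s)"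
        by (intro has_vector_derivative_diff der s)
      \<comment> \<open>The constant \<open>\<phi> 0\<close> cancels between the two mild equations,
        so the increment solves the equation classically.\<close>
      also have "\<phi> (h + s) - \<phi> s = A_e lam k rho (\<Phi> (h + s) - \<Phi> s)"
        using A_e_diff(2)[OF dom dom, of "h + s" s lam k rho] eq[of "h + s"] eq[of s] s h by simp
      finally show "((\<lambda>s. \<Phi> (h + s) - \<Phi> s) has_vector_derivative
          A_e lam k rho (\<Phi> (h + s) - \<Phi> s)) (at s)" .
    qed
    from mult_left_mono[OF this zero_le_power2[of "1 / h"]] show ?thesis
      unfolding lyap_scaleR by (simp only: mult.left_commute)
  qed
  \<comment> \<open>Right-hand difference quotients of the primitive tend to
    \<open>\<phi> t\<close>, including at time 0, and \<open>lyap\<close> is continuous.\<close>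
  have lim: "((\<lambda>h. lyap lam rho \<epsilon> ((1 / h) *\<^sub>R (\<Phi> (h + t) - \<Phi> t))) \<longlongrightarrow> lyap lam rho \<epsilon> (\<phi> t)) (at_right 0)"
    if t: "t \<ge> 0" for t
  proof -
    have "at t within {t<..<t + 1} = at_right t"
      by (rule at_within_nhd[of _ "{..<t + 1}"]) auto
    moreover have "(\<Phi> has_vector_derivative \<phi> t) (at t within {t<..<t + 1})"
      using der_within[of t "t + 1"] t by (auto elim: has_vector_derivative_within_subset)
    ultimately have "((\<lambda>y. (1 / norm (y - t)) *\<^sub>R (\<Phi> y - (\<Phi> t + (y - t) *\<^sub>R \<phi> t))) \<longlongrightarrow> 0) (at_right t)"
      by (simp add: has_vector_derivative_def has_derivative_within)
    then have "((\<lambda>h. (1 / norm h) *\<^sub>R (\<Phi> (h + t) - (\<Phi> t + h *\<^sub>R \<phi> t))) \<longlongrightarrow> 0) (at_right 0)"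
      by (subst (asm) filterlim_at_right_to_0) simp
    then have "((\<lambda>h. (1 / h) *\<^sub>R (\<Phi> (h + t) - \<Phi> t) - \<phi> t) \<longlongrightarrow> 0) (at_right 0)"
      by (rule Lim_transform_eventually)
        (auto simp: eventually_at_right_less algebra_simps intro: eventually_mono[OF eventually_at_right_less])
    then have "((\<lambda>h. (1 / h) *\<^sub>R (\<Phi> (h + t) - \<Phi> t)) \<longlongrightarrow> \<phi> t) (at_right 0)"
      by (simp add: LIM_zero_iff)
    moreover have "isCont (lyap lam rho \<epsilon>) (\<phi> t)"
      using continuous_on_lyap by (meson UNIV_I continuous_on_eq_continuous_at open_UNIV)
    ultimately show ?thesis by (rule isCont_tendsto_compose[rotated])
  qed
  show ?thesis
  proof (rule tendsto_le[OF _ tendsto_mult_left[OF lim[of 0]] lim[OF t]])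
    show "eventually (\<lambda>h. lyap lam rho \<epsilon> ((1 / h) *\<^sub>R (\<Phi> (h + t) - \<Phi> t))
        \<le> exp (- decay_rate * t) * lyap lam rho \<epsilon> ((1 / h) *\<^sub>R (\<Phi> (h + 0) - \<Phi> 0))) (at_right 0)"
      using eventually_at_right_less by eventually_elim (rule step)
  qed auto
qed

text \<open>By \<open>lyap_ge\<close>, \<open>lyap\<close> dominates a positive multiple of the
  squared second component, which therefore inherits the exponential decay.\<close>

lemma snd_mild_tendsto_0:
  assumes "is_solution (A_e lam k rho) (dom_A_e gam) \<infinity> \<phi>"
  shows "((\<lambda>t. snd (\<phi> t)) \<longlongrightarrow> 0) at_top"
proof -
  \<comment> \<open>The factor \<open>4 * rho / lam\<close> inverts the coefficient of
    \<open>c\<^sup>2\<close> in \<open>lyap_ge\<close>.\<close>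
  define M where "M = 4 * rho / lam * lyap lam rho \<epsilon> (\<phi> 0)"
  have "((\<lambda>t. exp (- decay_rate * t)) \<longlongrightarrow> 0) at_top"
    using decay_rate_pos
    by (intro filterlim_compose[OF exp_at_bot] filterlim_tendsto_neg_mult_at_bot[OF tendsto_const]
        filterlim_ident) auto
  then have lim: "((\<lambda>t. M * exp (- decay_rate * t)) \<longlongrightarrow> 0) at_top"
    by (rule tendsto_mult_right_zero)
  have "(snd (\<phi> t))\<^sup>2 \<le> M * exp (- decay_rate * t)" if "t \<ge> 0" for t
  proof -
    have "lam / (4 * rho) * (snd (\<phi> t))\<^sup>2 \<le> lyap lam rho \<epsilon> (\<phi> t)"
      using order_trans[OF _ lyap_ge[of "fst (\<phi> t)" "snd (\<phi> t)"]] by simp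
    also note lyap_mild_decay[OF assms that]
    finally show ?thesis using pos by (simp add: M_def field_simps)
  qed
  then have "eventually (\<lambda>t. norm ((snd (\<phi> t))\<^sup>2) \<le> M * exp (- decay_rate * t)) at_top"
    by (intro eventually_mono[OF eventually_ge_at_top[of 0]]) simp
  then have "((\<lambda>t. (snd (\<phi> t))\<^sup>2) \<longlongrightarrow> 0) at_top"
    by (rule Lim_null_comparison[OF _ lim])
  then show ?thesis by simp
qed

end

lemma small_coupling_exists:
  fixes lam k rho gam :: real
  assumes "lam > 0" "k > 0" "rho > 0" "gam > 0"
  shows "\<exists>\<epsilon>. small_coupling lam k rho gam \<epsilon>"
proof -
  define A where "A = lam * gam\<^sup>2 + rho / 2"
  define B where "B = k\<^sup>2 / lam + rho / 2"
  have AB: "A > 0" "B > 0"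
    using assms by (auto simp: A_def B_def intro!: add_nonneg_pos)
  \<comment> \<open>One entry for each smallness condition, solved for the coupling; all four are
    positive.\<close>
  define \<epsilon> where "\<epsilon> = min (min (1 / 2) (lam / (2 * rho))) (min (lam * gam / A) (k / 2 / B))"
  have "\<epsilon> > 0"
    using AB assms by (simp add: \<epsilon>_def)
  moreover have "\<epsilon> \<le> 1 / 2" "\<epsilon> \<le> lam / (2 * rho)" and AB_le: "\<epsilon> \<le> lam * gam / A" "\<epsilon> \<le> k / 2 / B"
    unfolding \<epsilon>_def by (blast intro: min.cobounded1 min.cobounded2 order_trans)+
  moreover have "\<epsilon> * A \<le> lam * gam" "\<epsilon> * B \<le> k / 2"
    using AB AB_le by (simp_all only: pos_le_divide_eq)
  ultimately have "small_coupling lam k rho gam \<epsilon>"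
    using assms by unfold_locales (simp_all only: A_def B_def)
  then show ?thesis ..
qed

section \<open>Convergence of the parameter estimate\<close>

lemma g_lambda_strict_mono:
  assumes "lam > 0" "0 \<le> x" "x < y"
  shows "g_lambda lam x < g_lambda lam y"
proof -
  have *: "0 \<le> sqrt (x / lam)" "sqrt (x / lam) < sqrt (y / lam)"
    using assms by (auto simp: divide_strict_right_mono)
  then have "tanh (sqrt (x / lam)) < tanh (sqrt (y / lam))" by simp
  with * show ?thesis
    unfolding g_lambda_def by (intro mult_strict_mono') auto
qed

text \<open>Order-theoretic continuity of the inverse: strict monotonicity turns bounds on the
  argument by values of \<open>g_lambda\<close> around \<open>g_lambda lam k\<close> into bounds on
  the preimage around \<open>k\<close>.\<close>

lemma g_lambda_inv_tendsto:
  assumes lam: "lam > 0" and k: "k > 0" and f: "(f \<longlongrightarrow> g_lambda lam k) F"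
    and nonneg: "eventually (\<lambda>t. f t \<ge> 0) F"
  shows "((\<lambda>t. g_lambda_inv lam (f t)) \<longlongrightarrow> k) F"
proof -
  have bij: "bij_betw (g_lambda lam) {0..} {0..}" by (rule g_lambda_bij_betw[OF lam])
  have inv: "g_lambda_inv lam y \<ge> 0" "g_lambda lam (g_lambda_inv lam y) = y" if "y \<ge> 0" for y
    using that bij_betwE[OF bij_betw_the_inv_into[OF bij]] f_the_inv_into_f_bij_betw[OF bij]
    by (auto simp: g_lambda_inv_def)
  have mono: "a < b" if "g_lambda lam a < g_lambda lam b" "a \<ge> 0" "b \<ge> 0" for a b
    using g_lambda_strict_mono[OF lam, of b a] that by (cases a b rule: linorder_cases) auto
  show ?thesis
  proof (rule order_tendstoI)
    fix a assume a: "a < k"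
    \<comment> \<open>Monotonicity is available on the nonnegative half line; a negative
      \<open>a\<close> lies below every value of the inverse on nonnegative arguments.\<close>
    show "eventually (\<lambda>t. a < g_lambda_inv lam (f t)) F"
    proof (cases "a < 0")
      case True
      from nonneg show ?thesis
        by eventually_elim (use True inv(1) in \<open>auto intro: less_le_trans\<close>)
    next
      case False
      then have "g_lambda lam a < g_lambda lam k"
        using g_lambda_strict_mono[OF lam _ a] by simp
      from order_tendstoD(1)[OF f this] nonneg show ?thesis
        by eventually_elim (use False inv mono in auto)
    qed
  next
    fix a assume a: "k < a"
    then have "g_lambda lam k < g_lambda lam a"
      using g_lambda_strict_mono[OF lam _ a] k by simp
    from order_tendstoD(2)[OF f this] nonneg show "eventually (\<lambda>t. g_lambda_inv lam (f t) < a) F"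
      by eventually_elim (use a k inv mono in auto)
  qed
qed

theorem corollary1:
  fixes lam k rho gam y_r :: real
    and u_err :: "real \<Rightarrow> l2" and chi_err chi k_hat :: "real \<Rightarrow> real"
  assumes "lam > 0" and "k > 0" and "rho > 0" and "gam > 0" and "y_r \<noteq> 0"
    and "is_maximal_solution (A_e lam k rho) (dom_A_e gam) \<infinity> (\<lambda>t. (u_err t, chi_err t))"
    and "\<And>t. t \<ge> 0 \<Longrightarrow> chi t = chi_err t + sqrt (k / lam) * tanh (sqrt (k / lam)) * y_r"
    and "\<And>t. t \<ge> 0 \<Longrightarrow> k_hat t = g_lambda_inv lam (max 0 (chi t / y_r))"
  shows "((\<lambda>t. \<bar>k - k_hat t\<bar>) \<longlongrightarrow> 0) at_top"
proof -
  obtain \<epsilon> where "small_coupling lam k rho gam \<epsilon>"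
    using small_coupling_exists assms(1-4) by blast
  then interpret small_coupling lam k rho gam \<epsilon> .
  have "(chi_err \<longlongrightarrow> 0) at_top"
    using snd_mild_tendsto_0 assms(6) by (fastforce simp: is_maximal_solution_def)
  then have "((\<lambda>t. max 0 (chi_err t / y_r + g_lambda lam k)) \<longlongrightarrow> max 0 (0 / y_r + g_lambda lam k)) at_top"
    by (intro tendsto_intros assms(5))
  \<comment> \<open>The target value is nonnegative, so the truncation at 0 leaves the limit
    unchanged.\<close>
  moreover have "max 0 (0 / y_r + g_lambda lam k) = g_lambda lam k"
    using assms(1,2) by (simp add: g_lambda_def)
  ultimately have "((\<lambda>t. g_lambda_inv lam (max 0 (chi_err t / y_r + g_lambda lam k))) \<longlongrightarrow> k) at_top"
    by (intro g_lambda_inv_tendsto assms) simp_all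
  \<comment> \<open>Dividing by \<open>y_r\<close> turns the equilibrium value of \<open>chi\<close>
    into \<open>g_lambda lam k\<close>; the defining equations hold for \<open>t \<ge> 0\<close>,
    hence eventually.\<close>
  moreover have "eventually (\<lambda>t. g_lambda_inv lam (max 0 (chi_err t / y_r + g_lambda lam k)) = k_hat t) at_top"
    using eventually_ge_at_top[of 0]
    by eventually_elim (use assms(5,7,8) in \<open>simp add: g_lambda_def add_divide_distrib\<close>)
  ultimately have "(k_hat \<longlongrightarrow> k) at_top"
    by (rule Lim_transform_eventually)
  then have "((\<lambda>t. k - k_hat t) \<longlongrightarrow> k - k) at_top"
    by (intro tendsto_intros)
  then show ?thesis by (simp add: tendsto_rabs_zero_iff)
qed

end
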